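(* Let $G$ be a finite group and $H\le G$ a subgroup such that $(G,H)$ is a Gel'fand pair. Let $k>0$ be any number of registers. For the family $\{\boldsymbol{\rho}_g\}_{g\in G}$ of density matrices on $\mathbb{C}[G^k]=\mathbb{C}[G]^{\otimes k}$ corresponding to random left cosets of the subgroups $(H^g)^k\subset G^k$, $$\boldsymbol{\rho}_g=\rho_g^{\otimes k}=\frac{1}{|G|^k}\sum_{\mathbf{c}\in G^k}|\mathbf{c}(H^g)^k\rangle\langle\mathbf{c}(H^g)^k|,$$ with the uniform distribution $p_g=1/|G|$ on $g\in G$, the pretty good measurement $\{E_g\}_{g\in G}$ maximizes the probability of correctly measuring $g$. That is, for every measurement $\{F_g\}_{g\in G}$ on $\mathbb{C}[G^k]$, $$\frac{1}{|G|}\sum_{g\in G}\operatorname{tr}(F_g\boldsymbol{\rho}_g)\;\le\;\frac{1}{|G|}\sum_{g\in G}\operatorname{tr}(E_g\boldsymbol{\rho}_g).$$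
   Context: $\mathbb{C}[G]$ is the Hilbert space with orthonormal basis $\{|x\rangle : x\in G\}$, and $\mathbb{C}[G^k]=\mathbb{C}[G]^{\otimes k}$ likewise. For $g\in G$, $H^g=g^{-1}Hg$, and for $c\in G$, $|cH^g\rangle=\frac{1}{\sqrt{|H|}}\sum_{h\in H^g}|ch\rangle$ and $\rho_g=\frac{1}{|G|}\sum_{c\in G}|cH^g\rangle\langle cH^g|$. For $\mathbf{c}=(c_1,\dots,c_k)\in G^k$, $|\mathbf{c}(H^g)^k\rangle=|c_1H^g\rangle\otimes\cdots\otimes|c_kH^g\rangle$. The pair $(G,H)$ is a Gel'fand pair if the algebra (under convolution) of functions $f:G\to\mathbb{C}$ with $f(hg)=f(g)=f(gh)$ for all $g\in G$, $h\in H$ is commutative. Equivalently: the induced representation $\operatorname{Ind}_H^G\mathbb{1}$ of the trivial representation contains each irreducible representation $\sigma$ of $G$ at most once; equivalently, for every irreducible $\sigma$ and every such bi-invariant $f$, $\sum_g f(g)\sigma(g)$ has rank at most one. A measurement (POVM) with outcomes in a finite set $I$ is a family of positive semidefinite operators $\{F_i\}_{i\in I}$ satisfying the completeness condition $\sum_i F_i=\mathbb{1}$, where the family is allowed to be completed by one additional positive semidefinite operator corresponding to an extra outcome that never counts as a correct answer (so equivalently $\sum_{i\in I}F_i\le \mathbb{1}$). If state $\rho_i$ occurs with probability $p_i$, the success probability is $\sum_i p_i\operatorname{tr}(F_i\rho_i)$. The pretty good measurement (PGM) of a family of density matrices $\rho_i$ with probabilities $p_i$ is $\{E_i\}$, where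 $E_i=p_iM^{-1/2}\rho_iM^{-1/2}$, $M=\sum_i p_i\rho_i$, and $M^{-1/2}$ is the inverse square root of $M$ on the image of $M$ (extended by zero on the orthogonal complement), so that $(M^{-1/2})^2M$ is the orthogonal projection onto the image of $M$. If $M$ is not of full rank, the PGM is completed by the additional operator projecting onto the orthogonal complement of the image of $M$. *)

theory Defs
  imports
    "HOL-Algebra.Coset"
    "HOL-Library.FuncSet"
    "Jordan_Normal_Form.Matrix"
begin

section \<open>Operators on a finite-dimensional Hilbert space\<close>

definition sum_mat :: "nat \<Rightarrow> ('i \<Rightarrow> complex mat) \<Rightarrow> 'i set \<Rightarrow> complex mat" where
  "sum_mat n A I = mat n n (\<lambda>rc. \<Sum>i\<in>I. A i $$ rc)"

definition trace_mat :: "complex mat \<Rightarrow> complex" where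
  "trace_mat A = (\<Sum>i<dim_row A. A $$ (i, i))"

definition outer_prod :: "complex vec \<Rightarrow> complex mat" where
  "outer_prod v = mat (dim_vec v) (dim_vec v) (\<lambda>(i, j). v $ i * cnj (v $ j))"

text \<open>The order on \<^typ>\<open>complex\<close> is the one where \<open>0 \<le> z\<close> means that \<open>z\<close> is real and
  nonnegative. Requiring it for all values of the quadratic form forces the matrix to be
  Hermitian. The sesquilinear form \<open>u \<bullet>c v\<close> is conjugate linear in \<open>v\<close>.\<close>

definition psd :: "nat \<Rightarrow> complex mat \<Rightarrow> bool" where
  "psd n A \<longleftrightarrow> A \<in> carrier_mat n n \<and> (\<forall>v\<in>carrier_vec n. 0 \<le> (A *\<^sub>v v) \<bullet>c v)"

definition mat_image :: "nat \<Rightarrow> complex mat \<Rightarrow> complex vec set" where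
  "mat_image n M = (\<lambda>v. M *\<^sub>v v) ` carrier_vec n"

definition is_orth_proj :: "nat \<Rightarrow> complex mat \<Rightarrow> complex vec set \<Rightarrow> bool" where
  "is_orth_proj n P W \<longleftrightarrow> P \<in> carrier_mat n n \<and>
     (\<forall>v\<in>carrier_vec n. P *\<^sub>v v \<in> W \<and> (\<forall>w\<in>W. (v - P *\<^sub>v v) \<bullet>c w = 0))"

text \<open>For positive semidefinite \<open>M\<close> exactly one matrix satisfies the following description:
  the inverse square root of \<open>M\<close> on its image, extended by zero on the orthogonal complement.\<close>

definition is_inv_sqrt :: "nat \<Rightarrow> complex mat \<Rightarrow> complex mat \<Rightarrow> bool" where
  "is_inv_sqrt n M N \<longleftrightarrow> psd n N \<and>
     is_orth_proj n (N * N * M) (mat_image n M) \<and>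
     (\<forall>w\<in>carrier_vec n. (\<forall>u\<in>mat_image n M. w \<bullet>c u = 0) \<longrightarrow> N *\<^sub>v w = 0\<^sub>v n)"

definition inv_sqrt_mat :: "nat \<Rightarrow> complex mat \<Rightarrow> complex mat" where
  "inv_sqrt_mat n M = (THE N. is_inv_sqrt n M N)"

section \<open>Measurements and the pretty good measurement\<close>

text \<open>The operators sum to at most the identity; the difference is the operator of the
  additional outcome, which never counts as a correct answer.\<close>

definition measurement :: "nat \<Rightarrow> 'i set \<Rightarrow> ('i \<Rightarrow> complex mat) \<Rightarrow> bool" where
  "measurement n I F \<longleftrightarrow> (\<forall>i\<in>I. psd n (F i)) \<and> psd n (1\<^sub>m n - sum_mat n F I)"

text \<open>The traces below are real for positive semidefinite operators; \<^const>\<open>Re\<close> only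
  changes the type.\<close>

definition success_prob ::
  "'i set \<Rightarrow> ('i \<Rightarrow> real) \<Rightarrow> ('i \<Rightarrow> complex mat) \<Rightarrow> ('i \<Rightarrow> complex mat) \<Rightarrow> real" where
  "success_prob I p \<rho> F = (\<Sum>i\<in>I. p i * Re (trace_mat (F i * \<rho> i)))"

definition pgm ::
  "nat \<Rightarrow> 'i set \<Rightarrow> ('i \<Rightarrow> real) \<Rightarrow> ('i \<Rightarrow> complex mat) \<Rightarrow> 'i \<Rightarrow> complex mat" where
  "pgm n I p \<rho> i =
     (let M = sum_mat n (\<lambda>j. complex_of_real (p j) \<cdot>\<^sub>m \<rho> j) I;
          N = inv_sqrt_mat n M
      in complex_of_real (p i) \<cdot>\<^sub>m (N * \<rho> i * N))"

section \<open>Gel'fand pairs\<close>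

definition bi_invariant :: "('a, 'm) monoid_scheme \<Rightarrow> 'a set \<Rightarrow> ('a \<Rightarrow> complex) \<Rightarrow> bool" where
  "bi_invariant G H f \<longleftrightarrow>
     (\<forall>g\<in>carrier G. \<forall>h\<in>H. f (h \<otimes>\<^bsub>G\<^esub> g) = f g \<and> f (g \<otimes>\<^bsub>G\<^esub> h) = f g)"

definition convolution ::
  "('a, 'm) monoid_scheme \<Rightarrow> ('a \<Rightarrow> complex) \<Rightarrow> ('a \<Rightarrow> complex) \<Rightarrow> 'a \<Rightarrow> complex" where
  "convolution G f f' x = (\<Sum>y\<in>carrier G. f y * f' (inv\<^bsub>G\<^esub> y \<otimes>\<^bsub>G\<^esub> x))"

definition gelfand_pair :: "('a, 'm) monoid_scheme \<Rightarrow> 'a set \<Rightarrow> bool" where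
  "gelfand_pair G H \<longleftrightarrow>
     (\<forall>f f'. bi_invariant G H f \<longrightarrow> bi_invariant G H f' \<longrightarrow>
        (\<forall>x\<in>carrier G. convolution G f f' x = convolution G f' f x))"

section \<open>Coset states of conjugate subgroups\<close>

definition conj_subgroup :: "('a, 'm) monoid_scheme \<Rightarrow> 'a set \<Rightarrow> 'a \<Rightarrow> 'a set" where
  "conj_subgroup G H g = (inv\<^bsub>G\<^esub> g <#\<^bsub>G\<^esub> H) #>\<^bsub>G\<^esub> g"

text \<open>The coefficient of the coset vector \<open>|cH\<^sup>g\<rangle>\<close> at the basis vector \<open>|x\<rangle>\<close>, and the
  \<open>(x, y)\<close> entry of the single-register state \<open>\<rho>\<^sub>g\<close>.\<close>

definition coset_coeff ::
  "('a, 'm) monoid_scheme \<Rightarrow> 'a set \<Rightarrow> 'a \<Rightarrow> 'a \<Rightarrow> 'a \<Rightarrow> complex" where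
  "coset_coeff G H g c x =
     1 / complex_of_real (sqrt (real (card H))) *
     (\<Sum>h\<in>conj_subgroup G H g. if x = c \<otimes>\<^bsub>G\<^esub> h then 1 else 0)"

definition single_coset_state ::
  "('a, 'm) monoid_scheme \<Rightarrow> 'a set \<Rightarrow> 'a \<Rightarrow> 'a \<Rightarrow> 'a \<Rightarrow> complex" where
  "single_coset_state G H g x y =
     1 / of_nat (card (carrier G)) *
     (\<Sum>c\<in>carrier G. coset_coeff G H g c x * cnj (coset_coeff G H g c y))"

abbreviation tuples :: "('a, 'm) monoid_scheme \<Rightarrow> nat \<Rightarrow> (nat \<Rightarrow> 'a) set" where
  "tuples G k \<equiv> {..<k} \<rightarrow>\<^sub>E carrier G"

text \<open>Matrices are indexed by numbers, so the orthonormal basis of \<open>\<complex>[G\<^sup>k]\<close> has to be ordered: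
  \<open>b\<close> enumerates the tuples, and coordinate \<open>i\<close> belongs to the basis vector
  \<open>|b i\<rangle> = |b i 0\<rangle> \<otimes> \<dots> \<otimes> |b i (k - 1)\<rangle>\<close>.\<close>

definition coset_vec ::
  "('a, 'm) monoid_scheme \<Rightarrow> 'a set \<Rightarrow> nat \<Rightarrow> (nat \<Rightarrow> nat \<Rightarrow> 'a) \<Rightarrow> 'a \<Rightarrow> (nat \<Rightarrow> 'a) \<Rightarrow> complex vec"
  where
  "coset_vec G H k b g c =
     vec (card (carrier G) ^ k) (\<lambda>i. \<Prod>l<k. coset_coeff G H g (c l) (b i l))"

definition coset_state ::
  "('a, 'm) monoid_scheme \<Rightarrow> 'a set \<Rightarrow> nat \<Rightarrow> (nat \<Rightarrow> nat \<Rightarrow> 'a) \<Rightarrow> 'a \<Rightarrow> complex mat" where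
  "coset_state G H k b g =
     (1 / of_nat (card (carrier G)) ^ k) \<cdot>\<^sub>m
     sum_mat (card (carrier G) ^ k) (\<lambda>c. outer_prod (coset_vec G H k b g c)) (tuples G k)"

text \<open>The coset state is the \<open>k\<close>-fold tensor power of the single-register state.\<close>

lemma coset_state_tensor_power:
  assumes "finite (carrier G)" "i < card (carrier G) ^ k" "j < card (carrier G) ^ k"
  shows "coset_state G H k b g $$ (i, j) =
           (\<Prod>l<k. single_coset_state G H g (b i l) (b j l))"
proof -
  have "(\<Prod>l<k. single_coset_state G H g (b i l) (b j l)) =
      (1 / of_nat (card (carrier G))) ^ k *
      (\<Prod>l<k. \<Sum>c\<in>carrier G. coset_coeff G H g c (b i l) * cnj (coset_coeff G H g c (b j l)))"
    unfolding single_coset_state_def by (subst prod.distrib) simp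
  also have "\<dots> = (1 / of_nat (card (carrier G))) ^ k *
      (\<Sum>c\<in>tuples G k.
         \<Prod>l<k. coset_coeff G H g (c l) (b i l) * cnj (coset_coeff G H g (c l) (b j l)))"
    using assms(1) by (subst prod_sum_PiE) auto
  finally show ?thesis
    using assms(2,3)
    by (simp add: coset_state_def sum_mat_def outer_prod_def coset_vec_def
        prod.distrib power_one_over)
qed

end

(*
  Put A_g = p_g rho_g, M = sum_g A_g and N = M^(-1/2). If a positive C commutes with all A_g and
  A_g N A_g = C A_g, then X = M^(-1/4) A_g M^(-1/4) satisfies X^2 = C X, hence X <= C and
  A_g <= C M^(1/2). As C M^(1/2) = sum_g N A_g N A_g, this operator is a dual certificate: its
  trace bounds the success probability of every measurement and is the value of the pretty good
  measurement.

  Let e be the projection given by right translation averaged over L = H^k in K = G^k. Then A_g is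
  a multiple of e conjugated by the right translation by the diagonal element (g,...,g), and N is a
  right convolution operator that commutes with these diagonal translations. So e N e lies in the
  Hecke algebra of (K, L). That algebra is commutative, and this makes e N e = C e for some C in
  the centre of the group algebra.
*)
theory Submission
  imports Defs "Jordan_Normal_Form.Schur_Decomposition"
    "Jordan_Normal_Form.Jordan_Normal_Form_Existence"
    "Jordan_Normal_Form.Jordan_Normal_Form_Uniqueness"
    "HOL-Algebra.Product_Groups"
begin

section \<open>Hermitian and positive semidefinite matrices\<close>

text \<open>The obstacle is that \<open>N\<close> depends on all the conjugates at once, so
  \<open>A g * N * A g\<close> is controlled only through symmetries. Every \<open>A g\<close>
  commutes with left translations, hence so does every function of \<open>M\<close>, and this makes
  \<open>N\<close> a convolution. Conjugation by a diagonal translation merely permutes the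
  \<open>A g\<close>, so it fixes \<open>M\<close> and \<open>N\<close>; this moves the claim for
  each \<open>g\<close> to the one operator \<open>e N e\<close>. The certificate has to commute
  with all \<open>A g\<close> simultaneously. The Hecke element \<open>e N e\<close> does not do so
  in general, which is why a central \<open>C\<close> with the same effect on \<open>e\<close> is
  sought. \<open>X <= C\<close> holds because \<open>X\<close> and \<open>C\<close> commute:
  \<open>X\<close> agrees with \<open>C\<close> on the image of \<open>X\<close>, and
  \<open>C - X\<close> is \<open>C\<close> on its kernel. \<open>M\<close> may be singular; its
  powers are set to 0 on the kernel, where every \<open>A g\<close> vanishes too. Finally,
  commutativity is assumed for \<open>(G, H)\<close> but needed for \<open>(K, L)\<close>.
  Bi-invariant functions on \<open>K\<close> need not be products, but the functions counting
  representations \<open>h a h' = x\<close> are products and span them.\<close>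

lemma mat_adjoint_dim [simp]:
  "dim_row (mat_adjoint A) = dim_col A" "dim_col (mat_adjoint A) = dim_row A"
  unfolding mat_adjoint_def by auto

lemma mat_adjoint_carrier [simp]:
  "A \<in> carrier_mat n m \<Longrightarrow> mat_adjoint A \<in> carrier_mat m n"
  by auto

lemma mat_adjoint_index [simp]:
  fixes A :: "complex mat"
  assumes "i < dim_col A" "j < dim_row A"
  shows "mat_adjoint A $$ (i, j) = cnj (A $$ (j, i))"
  using assms unfolding mat_adjoint_def by (auto simp: mat_of_rows_def)

lemma mat_adjoint_mult:
  fixes A B :: "complex mat"
  assumes "A \<in> carrier_mat n m" "B \<in> carrier_mat m l"
  shows "mat_adjoint (A * B) = mat_adjoint B * mat_adjoint A"
  by (rule eq_matI) (use assms in \<open>auto simp: scalar_prod_def mult.commute\<close>)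

lemma mat_adjoint_adjoint [simp]:
  fixes A :: "complex mat"
  shows "mat_adjoint (mat_adjoint A) = A"
  by (rule eq_matI) auto

lemma cscalar_mult_mat:
  fixes A :: "complex mat"
  assumes "A \<in> carrier_mat n m" "v \<in> carrier_vec m" "w \<in> carrier_vec n"
  shows "(A *\<^sub>v v) \<bullet>c w = v \<bullet>c (mat_adjoint A *\<^sub>v w)"
proof -
  have "(A *\<^sub>v v) \<bullet>c w = (\<Sum>i<n. \<Sum>j<m. A $$ (i,j) * v $ j * cnj (w $ i))"
    using assms by (simp add: scalar_prod_def sum_distrib_right atLeast0LessThan)
  also have "\<dots> = (\<Sum>j<m. \<Sum>i<n. A $$ (i,j) * v $ j * cnj (w $ i))"
    by (rule sum.swap)
  also have "\<dots> = v \<bullet>c (mat_adjoint A *\<^sub>v w)"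
    using assms by (simp add: scalar_prod_def sum_distrib_left atLeast0LessThan algebra_simps)
  finally show ?thesis .
qed

definition hermitian :: "nat \<Rightarrow> complex mat \<Rightarrow> bool" where
  "hermitian n A \<longleftrightarrow> A \<in> carrier_mat n n \<and> mat_adjoint A = A"

lemma hermitian_carrier: "hermitian n A \<Longrightarrow> A \<in> carrier_mat n n"
  by (simp add: hermitian_def)

lemma psd_carrier: "psd n A \<Longrightarrow> A \<in> carrier_mat n n"
  by (simp add: psd_def)

lemma cscalar_cnj:
  fixes u v :: "complex vec"
  assumes "u \<in> carrier_vec n" "v \<in> carrier_vec n"
  shows "v \<bullet>c u = cnj (u \<bullet>c v)"
  using assms by (simp add: scalar_prod_def mult.commute)

text \<open>\<open>p\<close> and \<open>q\<close> stand for the mixed terms Q(u,v) and Q(v,u) of a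
  sesquilinear form. The hypotheses are what remains of its realness at u + v and at u + \<i> v once
  the real diagonal terms drop out.\<close>

lemma complex_polarization:
  fixes p q :: complex
  assumes "Im (p + q) = 0" "Im (- \<i> * p + \<i> * q) = 0"
  shows "q = cnj p"
  using assms by (simp add: complex_eq_iff)

lemma psd_hermitian:
  assumes "psd n A"
  shows "hermitian n A"
proof -
  have A: "A \<in> carrier_mat n n" using assms by (rule psd_carrier)
  define Q where "Q u v = (A *\<^sub>v u) \<bullet>c v" for u v
  have Q: "Im (Q v v) = 0" if "v \<in> carrier_vec n" for v
    using assms that unfolding psd_def Q_def less_eq_complex_def by auto
  have ent: "Q (unit_vec n i) (unit_vec n j) = A $$ (j, i)" if "i < n" "j < n" for i j
    using A that unfolding Q_def
    by (simp add: scalar_prod_def unit_vec_def if_distrib[of cnj] if_distrib[of "(*) _"] sum.delta cong: if_cong)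
  have add: "Q (u + c \<cdot>\<^sub>v v) (u + c \<cdot>\<^sub>v v) = Q u u + cnj c * Q u v + c * Q v u + c * cnj c * Q v v"
    if "u \<in> carrier_vec n" "v \<in> carrier_vec n" for u v c
    using A that unfolding Q_def
    by (simp add: scalar_prod_def mult_add_distrib_mat_vec[of _ n n] sum.distrib algebra_simps sum_distrib_left)
  have "Q v u = cnj (Q u v)" if uv: "u \<in> carrier_vec n" "v \<in> carrier_vec n" for u v
  proof (rule complex_polarization)
    have "u + 1 \<cdot>\<^sub>v v \<in> carrier_vec n" "u + \<i> \<cdot>\<^sub>v v \<in> carrier_vec n" using uv by auto
    from this[THEN Q] show "Im (Q u v + Q v u) = 0" "Im (- \<i> * Q u v + \<i> * Q v u) = 0"
      using Q[OF uv(1)] Q[OF uv(2)] add[OF uv, of 1] add[OF uv, of \<i>] by simp_all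
  qed
  then have "cnj (A $$ (j, i)) = A $$ (i, j)" if "i < n" "j < n" for i j
    using ent that by (metis unit_vec_carrier)
  then have "mat_adjoint A = A"
    using A by (intro eq_matI) auto
  with A show ?thesis by (simp add: hermitian_def)
qed

lemma hermitian_cscalar:
  assumes "hermitian n A" "v \<in> carrier_vec n" "w \<in> carrier_vec n"
  shows "(A *\<^sub>v v) \<bullet>c w = v \<bullet>c (A *\<^sub>v w)"
  using cscalar_mult_mat[of A n n v w] assms by (simp add: hermitian_def)

lemma psd_conj:
  assumes "psd n A" "B \<in> carrier_mat n n"
  shows "psd n (mat_adjoint B * A * B)"
proof -
  have A: "A \<in> carrier_mat n n" using assms(1) by (rule psd_carrier)
  have B: "mat_adjoint B \<in> carrier_mat n n" using assms by simp
  have "0 \<le> (mat_adjoint B * A * B *\<^sub>v v) \<bullet>c v" if v: "v \<in> carrier_vec n" for v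
  proof -
    have "mat_adjoint B * A * B *\<^sub>v v = mat_adjoint B *\<^sub>v (A *\<^sub>v (B *\<^sub>v v))"
      using A B assms(2) v
      by (simp add: assoc_mult_mat_vec[of _ n n _ n] mult_carrier_mat[of _ n n _ n] mult_mat_vec_carrier[of _ n n])
    then have "(mat_adjoint B * A * B *\<^sub>v v) \<bullet>c v = (A *\<^sub>v (B *\<^sub>v v)) \<bullet>c (B *\<^sub>v v)"
      using cscalar_mult_mat[OF B, of "A *\<^sub>v (B *\<^sub>v v)" v] A B assms(2) v
      by (simp add: mult_mat_vec_carrier[of _ n n] del: assoc_mult_mat_vec assoc_mult_mat)
    then show ?thesis
      using assms v unfolding psd_def by auto
  qed
  moreover have "mat_adjoint B * A * B \<in> carrier_mat n n" using A B assms(2) by auto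
  ultimately show ?thesis unfolding psd_def by blast
qed

lemma psd_one: "psd n (1\<^sub>m n)"
  by (auto simp: psd_def)

lemma psd_square:
  assumes "hermitian n A"
  shows "psd n (A * A)"
  using psd_conj[OF psd_one, of A n] assms by (simp add: hermitian_def right_mult_one_mat[of _ n n])

lemma mat_mult_unit_vec:
  fixes A :: "complex mat"
  assumes "A \<in> carrier_mat n m" "j < m"
  shows "A *\<^sub>v unit_vec m j = col A j"
  by (rule eq_vecI) (use assms in \<open>auto simp: scalar_prod_def if_distrib cong: if_cong\<close>)

lemma mat_eqI_mult_vec:
  fixes A B :: "complex mat"
  assumes "A \<in> carrier_mat n m" "B \<in> carrier_mat n m"
    and "\<And>v. v \<in> carrier_vec m \<Longrightarrow> A *\<^sub>v v = B *\<^sub>v v"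
  shows "A = B"
proof (rule eq_matI)
  fix i j assume "i < dim_row B" "j < dim_col B"
  then have ij: "i < n" "j < m" using assms by auto
  have "A *\<^sub>v unit_vec m j = B *\<^sub>v unit_vec m j" using assms(3) by auto
  then have "col A j $ i = col B j $ i" using ij assms by (simp add: mat_mult_unit_vec)
  then show "A $$ (i, j) = B $$ (i, j)" using ij assms by simp
qed (use assms in auto)

section \<open>Functional calculus for Hermitian matrices\<close>

text \<open>\<open>P\<close> is invertible with inverse \<open>Q\<close> but need not be unitary,
  since it comes from a Jordan normal form. Adjoints are handled by comparing two diagonalizations
  of the same matrix.\<close>

definition diagonalizes ::
  "nat \<Rightarrow> complex mat \<Rightarrow> complex mat \<Rightarrow> (nat \<Rightarrow> real) \<Rightarrow> complex mat \<Rightarrow> bool" where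
  "diagonalizes n P Q d M \<longleftrightarrow> P \<in> carrier_mat n n \<and> Q \<in> carrier_mat n n \<and>
     P * Q = 1\<^sub>m n \<and> Q * P = 1\<^sub>m n \<and> M = P * mat_diag n (\<lambda>i. complex_of_real (d i)) * Q"

lemma jordan_matrix_diagonal:
  fixes n_as :: "(nat \<times> complex) list"
  assumes "\<forall>(m, a) \<in> set n_as. m \<le> 1" "i < sum_list (map fst n_as)" "j < sum_list (map fst n_as)" "i \<noteq> j"
  shows "jordan_matrix n_as $$ (i, j) = 0"
  using assms
proof (induction n_as arbitrary: i j)
  case (Cons na n_as)
  obtain m a where na: "na = (m, a)" by force
  have m: "m \<le> 1" using Cons.prems na by auto
  show ?case unfolding na jordan_matrix_Cons
  proof (subst index_mat_four_block, goal_cases)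
    case 3
    show ?case using Cons.prems na m Cons.IH[of "i - m" "j - m"]
      by (cases "i < m"; cases "j < m") auto
  qed (use Cons.prems na in auto)
qed simp

text \<open>Put w = B v and let B* be the adjoint. Normality gives B B* w = B* B w = 0, so the norm
  of B* w vanishes, and then the squared norm of B v is <v, B* w> = 0.\<close>

lemma normal_kernel_square:
  fixes B :: "complex mat"
  assumes B: "B \<in> carrier_mat n n" and nrm: "mat_adjoint B * B = B * mat_adjoint B"
    and v: "v \<in> carrier_vec n" and z: "B *\<^sub>v (B *\<^sub>v v) = 0\<^sub>v n"
  shows "B *\<^sub>v v = 0\<^sub>v n"
proof -
  let ?C = "mat_adjoint B"
  have C: "?C \<in> carrier_mat n n" using B by simp
  have Bv: "B *\<^sub>v v \<in> carrier_vec n" and CBv: "?C *\<^sub>v (B *\<^sub>v v) \<in> carrier_vec n"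
    using B C v by (auto intro!: mult_mat_vec_carrier[of _ n n])
  have "B *\<^sub>v (?C *\<^sub>v (B *\<^sub>v v)) = ?C *\<^sub>v (B *\<^sub>v (B *\<^sub>v v))"
    using arg_cong[OF nrm, of "\<lambda>X. X *\<^sub>v (B *\<^sub>v v)"] B C Bv by (simp add: assoc_mult_mat_vec[of _ n n _ n])
  also have "\<dots> = 0\<^sub>v n" unfolding z using B by (intro eq_vecI) auto
  finally have 0: "B *\<^sub>v (?C *\<^sub>v (B *\<^sub>v v)) = 0\<^sub>v n" .
  have "(?C *\<^sub>v (B *\<^sub>v v)) \<bullet>c (?C *\<^sub>v (B *\<^sub>v v)) = cnj ((B *\<^sub>v (?C *\<^sub>v (B *\<^sub>v v))) \<bullet>c (B *\<^sub>v v))"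
    using cscalar_mult_mat[OF B CBv Bv] cscalar_cnj[OF CBv CBv] by simp
  then have "?C *\<^sub>v (B *\<^sub>v v) = 0\<^sub>v n" using 0 Bv conjugate_square_eq_0_vec[OF CBv] by simp
  then have "(B *\<^sub>v v) \<bullet>c (B *\<^sub>v v) = 0"
    using cscalar_mult_mat[OF B v Bv] v by simp
  then show ?thesis using conjugate_square_eq_0_vec[OF Bv] by simp
qed

text \<open>The kernel of (M - a)^r has dimension the sum of min r m over the sizes m of the blocks
  for \<open>a\<close>. A block of size at least 2 would make it grow from r = 1 to r = 2, against
  \<open>normal_kernel_square\<close>. The argument goes through normality because \<open>a\<close>
  is not yet known to be real.\<close>

lemma hermitian_jordan_blocks:
  assumes M: "hermitian n M" and jnf: "jordan_nf M n_as"
  shows "\<forall>(m, a) \<in> set n_as. m \<le> 1"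
proof (intro ballI, clarify)
  fix m a assume ma: "(m, a) \<in> set n_as"
  have Mc: "M \<in> carrier_mat n n" using M by (rule hermitian_carrier)
  define B where "B = char_matrix M a"
  have B: "B \<in> carrier_mat n n" unfolding B_def using Mc by simp
  have Me: "cnj (M $$ (j, i)) = M $$ (i, j)" if "i < n" "j < n" for i j
    using mat_adjoint_index[of i M j] that M carrier_matD[OF Mc] unfolding hermitian_def by metis
  have Bd: "B = M + (- a) \<cdot>\<^sub>m 1\<^sub>m n" unfolding B_def char_matrix_def using Mc by simp
  have "mat_adjoint B = M + (- cnj a) \<cdot>\<^sub>m 1\<^sub>m n"
    by (rule eq_matI) (use Mc B Me in \<open>auto simp: Bd\<close>)
  then have "mat_adjoint B * B = B * mat_adjoint B"
    using Mc unfolding Bd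
    by (simp add: add_mult_distrib_mat[of _ n n _ _ n] mult_add_distrib_mat[of _ n n _ n])
      (intro eq_matI; auto simp: algebra_simps)
  note sq = normal_kernel_square[OF B this]
  have "mat_kernel (B * B) = mat_kernel B"
  proof (intro equalityI subsetI)
    fix v assume "v \<in> mat_kernel (B * B)"
    then show "v \<in> mat_kernel B"
      using B sq[of v] assoc_mult_mat_vec[of B n n B n v] by (simp add: mat_kernel_def)
  next
    fix v assume v: "v \<in> mat_kernel B"
    have "B *\<^sub>v 0\<^sub>v n = 0\<^sub>v n" using B by (intro eq_vecI) auto
    with v B show "v \<in> mat_kernel (B * B)"
      by (simp add: mat_kernel_def)
  qed
  then have "kernel_dim (B * B) = kernel_dim B"
    unfolding kernel_dim_def using B by simp
  then have "dim_gen_eigenspace M a 2 = dim_gen_eigenspace M a 1"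
    using B unfolding dim_gen_eigenspace_def B_def[symmetric] by (simp add: numeral_2_eq_2)
  then have eq: "sum_list (map (min 2) (map fst [(n, e)\<leftarrow>n_as . e = a]))
     = sum_list (map (min 1) (map fst [(n, e)\<leftarrow>n_as . e = a]))"
    unfolding dim_gen_eigenspace[OF jnf] .
  \<comment> \<open>Each term with min 1 is at most the term with min 2, so equal sums force
    equality term by term, that is, sizes at most 1.\<close>
  have *: "sum_list (map (min 2) xs) = sum_list (map (min 1) xs) \<Longrightarrow> x \<in> set xs \<Longrightarrow> x \<le> 1"
    for xs :: "nat list" and x
  proof (induction xs)
    case (Cons y ys)
    have "sum_list (map (min 1) ys) \<le> sum_list (map (min 2) ys)"
      by (rule sum_list_mono) auto
    moreover have "min 2 y + sum_list (map (min 2) ys) = min 1 y + sum_list (map (min 1) ys)"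
      using Cons.prems(1) by simp
    ultimately have "sum_list (map (min 2) ys) = sum_list (map (min 1) ys)" "y \<le> 1"
      by linarith+
    with Cons show ?case by auto
  qed simp
  show "m \<le> 1" by (rule *[OF eq]) (use ma in force)
qed

text \<open>The columns of \<open>P\<close> are eigenvectors. Through them the quadratic form of the
  matrix sees the diagonal entries although \<open>P\<close> is not unitary; this yields first that
  the eigenvalues are real and later that they are nonnegative.\<close>

lemma similarity_eigenvector:
  fixes P Q J :: "complex mat"
  assumes c: "P \<in> carrier_mat n n" "Q \<in> carrier_mat n n" "J \<in> carrier_mat n n"
    and QP: "Q * P = 1\<^sub>m n" and i: "i < n" and J: "J *\<^sub>v unit_vec n i = a \<cdot>\<^sub>v unit_vec n i"
  obtains v where "v \<in> carrier_vec n" "v \<noteq> 0\<^sub>v n" "P * J * Q *\<^sub>v v = a \<cdot>\<^sub>v v"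
proof -
  define v where "v = P *\<^sub>v unit_vec n i"
  have v: "v \<in> carrier_vec n" using c by (simp add: v_def mult_mat_vec_carrier[of _ n n])
  have Qv: "Q *\<^sub>v v = unit_vec n i"
    using c QP by (simp add: v_def assoc_mult_mat_vec[of _ n n _ n, symmetric])
  have "v \<noteq> 0\<^sub>v n"
  proof
    assume "v = 0\<^sub>v n"
    then have "Q *\<^sub>v v = 0\<^sub>v n" using c by (auto simp: mult_mat_vec_def scalar_prod_def)
    with Qv i show False by (metis index_unit_vec(2) index_zero_vec(1) zero_neq_one)
  qed
  moreover have "P * J * Q *\<^sub>v v = a \<cdot>\<^sub>v v"
    using c v Qv J by (simp add: assoc_mult_mat_vec[of _ n n _ n] mult_mat_vec[of _ n n] v_def)
  ultimately show ?thesis using v that by blast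
qed

lemma hermitian_diagonalizable:
  assumes M: "hermitian n M"
  obtains P Q d where "diagonalizes n P Q d M"
proof -
  have Mc: "M \<in> carrier_mat n n" using M by (rule hermitian_carrier)
  obtain n_as where jnf: "jordan_nf M n_as"
    using char_poly_factorized[OF Mc] jordan_nf_exists[OF Mc] by blast
  obtain P Q where w: "similar_mat_wit M (jordan_matrix n_as) P Q"
    using jnf unfolding jordan_nf_def similar_mat_def by auto
  define J where "J = jordan_matrix n_as"
  from w Mc have c: "P \<in> carrier_mat n n" "Q \<in> carrier_mat n n" "J \<in> carrier_mat n n"
    and PQ: "P * Q = 1\<^sub>m n" and QP: "Q * P = 1\<^sub>m n" and MJ: "M = P * J * Q"
    unfolding similar_mat_wit_def Let_def J_def by auto
  have sn: "sum_list (map fst n_as) = n" using c(3) unfolding J_def by (metis carrier_matD(1) jordan_matrix_dim(1))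
  have Joff: "J $$ (i, j) = 0" if "i < n" "j < n" "i \<noteq> j" for i j
    using jordan_matrix_diagonal[OF hermitian_jordan_blocks[OF M jnf], of i j] that
    unfolding J_def sn by simp
  have Jr: "J $$ (i, i) = complex_of_real (Re (J $$ (i, i)))" if i: "i < n" for i
  proof -
    have "J *\<^sub>v unit_vec n i = J $$ (i, i) \<cdot>\<^sub>v unit_vec n i"
      using c(3) i Joff by (intro eq_vecI) (auto simp: mat_mult_unit_vec)
    then obtain v where v: "v \<in> carrier_vec n" and v0: "v \<noteq> 0\<^sub>v n" and "M *\<^sub>v v = J $$ (i, i) \<cdot>\<^sub>v v"
      using similarity_eigenvector[OF c QP i] unfolding MJ by metis
    \<comment> \<open>The two sides are <M v, v> and <v, M v>.\<close>
    then have "J $$ (i, i) * (v \<bullet>c v) = cnj (J $$ (i, i)) * (v \<bullet>c v)"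
      using hermitian_cscalar[OF M v v] v by (simp add: conjugate_smult_vec)
    then have "J $$ (i, i) = cnj (J $$ (i, i))"
      using v0 conjugate_square_eq_0_vec[OF v] by simp
    then show ?thesis by (simp add: complex_eq_iff)
  qed
  have "J = mat_diag n (\<lambda>i. complex_of_real (Re (J $$ (i, i))))"
    by (rule eq_matI) (use c(3) Jr[symmetric] Joff in \<open>auto simp: mat_diag_def\<close>)
  then have "diagonalizes n P Q (\<lambda>i. Re (J $$ (i, i))) M"
    unfolding diagonalizes_def using c PQ QP MJ by auto
  then show ?thesis by (rule that)
qed

lemma square_mult_carrier [simp]:
  "A \<in> carrier_mat n n \<Longrightarrow> B \<in> carrier_mat n n \<Longrightarrow> A * B \<in> carrier_mat n n"
  by (rule mult_carrier_mat)

lemma square_mat_mult_one [simp]: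
  fixes A :: "complex mat"
  shows "A \<in> carrier_mat n n \<Longrightarrow> 1\<^sub>m n * A = A" "A \<in> carrier_mat n n \<Longrightarrow> A * 1\<^sub>m n = A"
  by auto

lemma square_mat_mult_assoc:
  fixes A B C :: "complex mat"
  shows "A \<in> carrier_mat n n \<Longrightarrow> B \<in> carrier_mat n n \<Longrightarrow> C \<in> carrier_mat n n \<Longrightarrow> A * B * C = A * (B * C)"
  by (rule assoc_mult_mat)

text \<open>The functional calculus, with an arbitrary choice of diagonalization;
  \<open>mat_fun_eq\<close> shows that the choice does not matter. The value is meaningful only if a
  diagonalization with real eigenvalues exists.\<close>

definition mat_fun :: "nat \<Rightarrow> (real \<Rightarrow> real) \<Rightarrow> complex mat \<Rightarrow> complex mat" where
  "mat_fun n f M = (case SOME (P, Q, d). diagonalizes n P Q d M of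
     (P, Q, d) \<Rightarrow> P * mat_diag n (\<lambda>i. complex_of_real (f (d i))) * Q)"

text \<open>In eigencoordinates \<open>X\<close> becomes \<open>Z\<close>, and the relation says
  that \<open>Z $$ (i, j)\<close> vanishes unless d j = d' i, in which case f takes the same value
  on both. The case \<open>X = 1\<close> with two diagonalizations of one matrix gives independence
  of the choice; the case of a single diagonalization gives commutation with
  \<open>mat_fun\<close>.\<close>

lemma diagonalizes_intertwine:
  assumes "diagonalizes n P Q d M" "diagonalizes n P' Q' d' M'"
    and X: "X \<in> carrier_mat n n" and XM: "X * M = M' * X"
  shows "X * (P * mat_diag n (\<lambda>i. complex_of_real (f (d i))) * Q) =
    (P' * mat_diag n (\<lambda>i. complex_of_real (f (d' i))) * Q') * X"
proof -
  let ?D = "mat_diag n (\<lambda>i. complex_of_real (d i))" and ?D' = "mat_diag n (\<lambda>i. complex_of_real (d' i))"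
  let ?F = "mat_diag n (\<lambda>i. complex_of_real (f (d i)))" and ?F' = "mat_diag n (\<lambda>i. complex_of_real (f (d' i)))"
  have c: "P \<in> carrier_mat n n" "Q \<in> carrier_mat n n" "P' \<in> carrier_mat n n" "Q' \<in> carrier_mat n n"
    and PQ: "P * Q = 1\<^sub>m n" and QP: "Q * P = 1\<^sub>m n" and M: "M = P * ?D * Q"
    and PQ': "P' * Q' = 1\<^sub>m n" and QP': "Q' * P' = 1\<^sub>m n" and M': "M' = P' * ?D' * Q'"
    using assms unfolding diagonalizes_def by auto
  define Z where "Z = Q' * X * P"
  have Z: "Z \<in> carrier_mat n n" unfolding Z_def using c X by simp
  have XZ: "X = P' * Z * Q"
  proof -
    have "P' * Z * Q = (P' * Q') * X * (P * Q)"
      unfolding Z_def using c X by (simp add: square_mat_mult_assoc[of _ n])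
    then show ?thesis using PQ PQ' X by simp
  qed
  have "Q' * (X * M) * P = Q' * (M' * X) * P" using XM by simp
  moreover have "Q' * (X * M) * P = Z * ?D * (Q * P)"
    unfolding Z_def M using c X by (simp add: square_mat_mult_assoc[of _ n])
  moreover have "Q' * (M' * X) * P = (Q' * P') * ?D' * Z"
    unfolding Z_def M' using c X by (simp add: square_mat_mult_assoc[of _ n])
  ultimately have ZD: "Z * ?D = ?D' * Z" using QP QP' Z by simp
  have "Z $$ (i, j) * complex_of_real (f (d j)) = complex_of_real (f (d' i)) * Z $$ (i, j)"
    if ij: "i < n" "j < n" for i j
  proof -
    have "(Z * ?D) $$ (i, j) = (?D' * Z) $$ (i, j)" using ZD by simp
    then have "Z $$ (i, j) * complex_of_real (d j) = complex_of_real (d' i) * Z $$ (i, j)"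
      using ij by (simp add: mat_diag_mult_left[OF Z] mat_diag_mult_right[OF Z])
    then have "Z $$ (i, j) = 0 \<or> d j = d' i" by (simp add: mult.commute)
    then show ?thesis by auto
  qed
  then have ZF: "Z * ?F = ?F' * Z"
    unfolding mat_diag_mult_left[OF Z] mat_diag_mult_right[OF Z] by (intro eq_matI) auto
  have "X * (P * ?F * Q) = P' * (Z * ?F) * Q"
  proof -
    have "X * (P * ?F * Q) = P' * Z * (Q * P) * ?F * Q"
      unfolding XZ using c Z by (simp add: square_mat_mult_assoc[of _ n])
    then show ?thesis using QP c Z by (simp add: square_mat_mult_assoc[of _ n])
  qed
  also have "\<dots> = (P' * ?F' * Q') * X"
  proof -
    have "(P' * ?F' * Q') * X = P' * ?F' * (Q' * P') * Z * Q"
      unfolding XZ using c Z by (simp add: square_mat_mult_assoc[of _ n])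
    then show ?thesis using QP' c Z ZF by (simp add: square_mat_mult_assoc[of _ n])
  qed
  finally show ?thesis .
qed

lemma mat_fun_eq:
  assumes D: "diagonalizes n P Q d M"
  shows "mat_fun n f M = P * mat_diag n (\<lambda>i. complex_of_real (f (d i))) * Q"
proof -
  obtain P' Q' d' where s: "(SOME (P, Q, d). diagonalizes n P Q d M) = (P', Q', d')"
    by (metis prod_cases3)
  have "case (SOME (P, Q, d). diagonalizes n P Q d M) of (P, Q, d) \<Rightarrow> diagonalizes n P Q d M"
    by (rule someI[of _ "(P, Q, d)"]) (use D in simp)
  then have D': "diagonalizes n P' Q' d' M" unfolding s by simp
  have c: "M \<in> carrier_mat n n" "P \<in> carrier_mat n n" "Q \<in> carrier_mat n n" "P' \<in> carrier_mat n n" "Q' \<in> carrier_mat n n"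
    using D D' unfolding diagonalizes_def by auto
  have "1\<^sub>m n * (P' * mat_diag n (\<lambda>i. complex_of_real (f (d' i))) * Q') =
      P * mat_diag n (\<lambda>i. complex_of_real (f (d i))) * Q * 1\<^sub>m n"
    by (rule diagonalizes_intertwine[OF D' D]) (use c in auto)
  moreover have "P' * mat_diag n (\<lambda>i. complex_of_real (f (d' i))) * Q' \<in> carrier_mat n n"
    "P * mat_diag n (\<lambda>i. complex_of_real (f (d i))) * Q \<in> carrier_mat n n"
    using c by simp_all
  ultimately show ?thesis unfolding mat_fun_def s by simp
qed

lemma diagonalizes_mat_fun:
  assumes "diagonalizes n P Q d M"
  shows "diagonalizes n P Q (\<lambda>i. f (d i)) (mat_fun n f M)"
  using assms mat_fun_eq[OF assms, of f] unfolding diagonalizes_def by auto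

lemma mat_fun_carrier [simp]:
  assumes "hermitian n M"
  shows "mat_fun n f M \<in> carrier_mat n n"
  by (rule hermitian_diagonalizable[OF assms]) (auto simp: mat_fun_eq diagonalizes_def)

lemma mat_fun_commute:
  assumes "hermitian n M" "X \<in> carrier_mat n n" "X * M = M * X"
  shows "X * mat_fun n f M = mat_fun n f M * X"
proof -
  obtain P Q d where D: "diagonalizes n P Q d M" using hermitian_diagonalizable[OF assms(1)] .
  show ?thesis using diagonalizes_intertwine[OF D D assms(2,3)] unfolding mat_fun_eq[OF D] .
qed

lemma mat_fun_mult:
  assumes "hermitian n M"
  shows "mat_fun n f M * mat_fun n g M = mat_fun n (\<lambda>x. f x * g x) M"
proof -
  obtain P Q d where D: "diagonalizes n P Q d M" using hermitian_diagonalizable[OF assms(1)] .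
  let ?F = "mat_diag n (\<lambda>i. complex_of_real (f (d i)))" and ?G = "mat_diag n (\<lambda>i. complex_of_real (g (d i)))"
  have c: "P \<in> carrier_mat n n" "Q \<in> carrier_mat n n" and QP: "Q * P = 1\<^sub>m n"
    using D unfolding diagonalizes_def by auto
  have "P * ?F * Q * (P * ?G * Q) = P * ?F * (Q * P) * ?G * Q"
    using c by (simp add: square_mat_mult_assoc[of _ n])
  also have "\<dots> = P * (?F * ?G) * Q"
    using c QP by (simp add: square_mat_mult_assoc[of _ n] del: mat_diag_diag)
  finally show ?thesis unfolding mat_fun_eq[OF D] by simp
qed

lemma mat_fun_id:
  assumes "hermitian n M"
  shows "mat_fun n (\<lambda>x. x) M = M"
  by (rule hermitian_diagonalizable[OF assms]) (auto simp: mat_fun_eq diagonalizes_def)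

lemma mat_fun_comp:
  assumes "hermitian n M"
  shows "mat_fun n g (mat_fun n f M) = mat_fun n (\<lambda>x. g (f x)) M"
proof -
  obtain P Q d where D: "diagonalizes n P Q d M" using hermitian_diagonalizable[OF assms(1)] .
  show ?thesis using mat_fun_eq[OF diagonalizes_mat_fun[OF D]] mat_fun_eq[OF D] by simp
qed

text \<open>Taking adjoints in M = P D Q gives a second diagonalization of the same
  \<open>M\<close>, by the adjoints of \<open>Q\<close> and \<open>P\<close>. Independence of the
  choice then identifies the function of \<open>M\<close> with its own adjoint.\<close>

lemma mat_fun_hermitian:
  assumes "hermitian n M"
  shows "hermitian n (mat_fun n f M)"
proof -
  obtain P Q d where D: "diagonalizes n P Q d M" using hermitian_diagonalizable[OF assms(1)] .
  have c: "P \<in> carrier_mat n n" "Q \<in> carrier_mat n n" and QP: "Q * P = 1\<^sub>m n" and PQ: "P * Q = 1\<^sub>m n"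
    using D unfolding diagonalizes_def by auto
  have dg: "mat_adjoint (mat_diag n (\<lambda>i. complex_of_real (r i))) = mat_diag n (\<lambda>i. complex_of_real (r i))" for r
    by (rule eq_matI) (auto simp: mat_diag_def)
  have one: "mat_adjoint (1\<^sub>m n) = (1\<^sub>m n :: complex mat)"
    by (rule eq_matI) auto
  have ad: "mat_adjoint (P * mat_diag n (\<lambda>i. complex_of_real (r i)) * Q) =
      mat_adjoint Q * mat_diag n (\<lambda>i. complex_of_real (r i)) * mat_adjoint P" for r
    using c by (simp add: mat_adjoint_mult[of _ n n _ n] dg square_mat_mult_assoc[of _ n])
  have "diagonalizes n (mat_adjoint Q) (mat_adjoint P) d M"
  proof -
    have "mat_adjoint Q * mat_adjoint P = 1\<^sub>m n" "mat_adjoint P * mat_adjoint Q = 1\<^sub>m n"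
      using c PQ QP one by (simp_all add: mat_adjoint_mult[of _ n n _ n, symmetric])
    moreover have "M = mat_adjoint Q * mat_diag n (\<lambda>i. complex_of_real (d i)) * mat_adjoint P"
      using assms D unfolding ad[symmetric] hermitian_def diagonalizes_def by simp
    ultimately show ?thesis unfolding diagonalizes_def using c by simp
  qed
  from mat_fun_eq[OF this, of f] mat_fun_eq[OF D, of f] ad[of "\<lambda>i. f (d i)"]
  show ?thesis using mat_fun_carrier[OF assms, of f] by (simp add: hermitian_def)
qed

lemma mat_fun_psd:
  assumes M: "hermitian n M" and f: "\<And>x. 0 \<le> f x"
  shows "psd n (mat_fun n f M)"
  using psd_square[OF mat_fun_hermitian[OF M, of "\<lambda>x. sqrt (f x)"]] f
  by (simp add: mat_fun_mult[OF M])

text \<open>The eigenvalues are nonnegative, so values of the functions at negative reals are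
  irrelevant. This permits total functions such as sqrt |x| in place of partial ones.\<close>

lemma mat_fun_cong_psd:
  assumes M: "psd n M" and fg: "\<And>x. 0 \<le> x \<Longrightarrow> f x = g x"
  shows "mat_fun n f M = mat_fun n g M"
proof -
  have herm: "hermitian n M" using M by (rule psd_hermitian)
  obtain P Q d where D: "diagonalizes n P Q d M" using hermitian_diagonalizable[OF herm] .
  have c: "P \<in> carrier_mat n n" "Q \<in> carrier_mat n n" and QP: "Q * P = 1\<^sub>m n"
    and MD: "M = P * mat_diag n (\<lambda>i. complex_of_real (d i)) * Q"
    using D unfolding diagonalizes_def by auto
  have "0 \<le> d i" if i: "i < n" for i
  proof -
    have "mat_diag n (\<lambda>i. complex_of_real (d i)) *\<^sub>v unit_vec n i = complex_of_real (d i) \<cdot>\<^sub>v unit_vec n i"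
      using i by (intro eq_vecI) (auto simp: mat_mult_unit_vec[of _ n] mat_diag_def)
    then obtain v where v: "v \<in> carrier_vec n" and v0: "v \<noteq> 0\<^sub>v n"
      and "M *\<^sub>v v = complex_of_real (d i) \<cdot>\<^sub>v v"
      using similarity_eigenvector[OF c mat_diag_dim QP i] unfolding MD by metis
    then have "0 \<le> complex_of_real (d i) * (v \<bullet>c v)"
      using M v unfolding psd_def by (auto dest!: bspec[of _ _ v])
    moreover have "0 < v \<bullet>c v" using v0 conjugate_square_greater_0_vec[OF v] by simp
    ultimately show ?thesis by (auto simp: less_eq_complex_def less_complex_def zero_le_mult_iff)
  qed
  then have "mat_diag n (\<lambda>i. complex_of_real (f (d i))) = mat_diag n (\<lambda>i. complex_of_real (g (d i)))"
    by (intro eq_matI) (auto simp: mat_diag_def fg)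
  then show ?thesis unfolding mat_fun_eq[OF D] by simp
qed

lemma mult_mat_vec_zero:
  fixes A :: "complex mat"
  assumes "A \<in> carrier_mat n m"
  shows "A *\<^sub>v 0\<^sub>v m = 0\<^sub>v n"
  using assms by (intro eq_vecI) auto

lemma square_mat_left_commute:
  fixes A B Z :: "complex mat"
  assumes "A * B = B * A" "A \<in> carrier_mat n n" "B \<in> carrier_mat n n" "Z \<in> carrier_mat n n"
  shows "A * (B * Z) = B * (A * Z)"
  using assoc_mult_mat[OF assms(2,3,4)] assoc_mult_mat[OF assms(3,2,4)] assms(1) by simp

lemma vec_diff_eq_zero:
  fixes u v :: "complex vec"
  assumes "u \<in> carrier_vec n" "v \<in> carrier_vec n" "u - v = 0\<^sub>v n"
  shows "u = v"
proof (rule eq_vecI)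
  fix i assume i: "i < dim_vec v"
  then have "(u - v) $ i = 0" using assms(2,3) by simp
  moreover have "(u - v) $ i = u $ i - v $ i" using i by simp
  ultimately show "u $ i = v $ i" using assms i by simp
qed (use assms in simp)

lemma mat_fun_mult_psd:
  assumes "psd n M" "\<And>x. 0 \<le> x \<Longrightarrow> f x * g x = h x"
  shows "mat_fun n f M * mat_fun n g M = mat_fun n h M"
  unfolding mat_fun_mult[OF psd_hermitian[OF assms(1)]]
  by (rule mat_fun_cong_psd[OF assms(1)]) (rule assms(2))

lemma mat_fun_mult_self_psd:
  assumes "psd n M" "\<And>x. 0 \<le> x \<Longrightarrow> f x * x = h x"
  shows "mat_fun n f M * M = mat_fun n h M" "M * mat_fun n f M = mat_fun n h M"
proof -
  have "x * f x = h x" if "0 \<le> x" for x using assms(2)[OF that] by (simp add: mult.commute)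
  then show "mat_fun n f M * M = mat_fun n h M" "M * mat_fun n f M = mat_fun n h M"
    using mat_fun_mult_psd[OF assms(1), of f "\<lambda>x. x" h] mat_fun_mult_psd[OF assms(1), of "\<lambda>x. x" f h] assms(2)
    by (simp_all add: mat_fun_id[OF psd_hermitian[OF assms(1)]])
qed

lemma mat_fun_eq_self_psd:
  assumes "psd n M" "\<And>x. 0 \<le> x \<Longrightarrow> f x = x"
  shows "mat_fun n f M = M"
  using mat_fun_cong_psd[OF assms(1), of f "\<lambda>x. x"] mat_fun_id[OF psd_hermitian[OF assms(1)]] assms(2)
  by simp

text \<open>The square root S of \<open>A\<close> also commutes with \<open>B\<close>, so A B = S B
  S.\<close>

lemma psd_mult_commute:
  assumes A: "psd n A" and B: "psd n B" and AB: "A * B = B * A"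
  shows "psd n (A * B)"
proof -
  let ?S = "mat_fun n sqrt A"
  have hA: "hermitian n A" using A by (rule psd_hermitian)
  have c: "A \<in> carrier_mat n n" "B \<in> carrier_mat n n" "?S \<in> carrier_mat n n"
    using A B hA by (auto simp: psd_carrier)
  have hS: "mat_adjoint ?S = ?S" using mat_fun_hermitian[OF hA, of sqrt] by (simp add: hermitian_def)
  have SS: "?S * ?S = A"
    using mat_fun_mult_psd[OF A, of sqrt sqrt "\<lambda>x. x"] mat_fun_id[OF hA] by simp
  have "B * ?S = ?S * B" by (rule mat_fun_commute[OF hA c(2) AB[symmetric]])
  then have "?S * B * ?S = ?S * ?S * B"
    using c by (simp add: square_mat_mult_assoc[of _ n])
  then show ?thesis using psd_conj[OF B c(3)] hS SS by simp
qed

text \<open>With the square root S of \<open>A\<close>, the form at \<open>v\<close> is the squared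
  norm of S v.\<close>

lemma psd_form_zero:
  assumes A: "psd n A" and v: "v \<in> carrier_vec n" and z: "(A *\<^sub>v v) \<bullet>c v = 0"
  shows "A *\<^sub>v v = 0\<^sub>v n"
proof -
  let ?S = "mat_fun n sqrt A"
  have hA: "hermitian n A" using A by (rule psd_hermitian)
  have S: "?S \<in> carrier_mat n n" using hA by simp
  have hS: "hermitian n ?S" by (rule mat_fun_hermitian[OF hA])
  have SS: "?S * ?S = A"
    using mat_fun_mult_psd[OF A, of sqrt sqrt "\<lambda>x. x"] mat_fun_id[OF hA] by simp
  have Sv: "?S *\<^sub>v v \<in> carrier_vec n" using S v by (rule mult_mat_vec_carrier)
  have Av: "A *\<^sub>v v = ?S *\<^sub>v (?S *\<^sub>v v)"
    using assoc_mult_mat_vec[OF S S v] SS by simp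
  have "(?S *\<^sub>v v) \<bullet>c (?S *\<^sub>v v) = 0"
    using hermitian_cscalar[OF hS Sv v] z Av by simp
  then have "?S *\<^sub>v v = 0\<^sub>v n" using conjugate_square_eq_0_vec[OF Sv] by simp
  then show ?thesis unfolding Av using S by (intro eq_vecI) auto
qed

section \<open>The inverse square root\<close>

text \<open>The convention \<open>inverse 0 = 0\<close> produces the extension by zero on the
  kernel, and the absolute value makes the function nonnegative on all reals, as
  \<open>mat_fun_psd\<close> asks. The product N N M is the indicator of nonzero eigenvalues, hence
  the projection onto the image.\<close>

lemma is_inv_sqrt_mat_fun:
  assumes M: "psd n M"
  shows "is_inv_sqrt n M (mat_fun n (\<lambda>x. inverse (sqrt \<bar>x\<bar>)) M)"
proof -
  let ?N = "mat_fun n (\<lambda>x. inverse (sqrt \<bar>x\<bar>)) M"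
  let ?P = "mat_fun n (\<lambda>x. if x = 0 then 0 else 1) M"
  let ?I = "mat_fun n inverse M"
  have hM: "hermitian n M" using M by (rule psd_hermitian)
  have c: "M \<in> carrier_mat n n" "?N \<in> carrier_mat n n" "?P \<in> carrier_mat n n" "?I \<in> carrier_mat n n"
    using M hM by (auto simp: psd_carrier)
  have NN: "?N * ?N = ?I" by (rule mat_fun_mult_psd[OF M]) (simp flip: inverse_mult_distrib)
  have IM: "?I * M = ?P" "M * ?I = ?P" by (rule mat_fun_mult_self_psd[OF M]; simp)+
  have PM: "?P * M = M"
    using mat_fun_mult_self_psd(1)[OF M, of "\<lambda>x. if x = 0 then 0 else 1" "\<lambda>x. x"] mat_fun_id[OF hM] by simp
  have NP: "?N * ?P = ?N" by (rule mat_fun_mult_psd[OF M]) simp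
  have hP: "hermitian n ?P" by (rule mat_fun_hermitian[OF hM])
  have "psd n ?N" by (rule mat_fun_psd[OF hM]) simp
  moreover have "is_orth_proj n ?P (mat_image n M)"
  proof -
    have "?P *\<^sub>v v \<in> mat_image n M" if v: "v \<in> carrier_vec n" for v
    proof -
      have "?P *\<^sub>v v = M *\<^sub>v (?I *\<^sub>v v)" using assoc_mult_mat_vec[OF c(1) c(4) v] IM(2) by simp
      then show ?thesis using mult_mat_vec_carrier[OF c(4) v] unfolding mat_image_def by blast
    qed
    moreover have "(v - ?P *\<^sub>v v) \<bullet>c w = 0" if v: "v \<in> carrier_vec n" and w: "w \<in> mat_image n M" for v w
    proof -
      obtain u where u: "u \<in> carrier_vec n" and wu: "w = M *\<^sub>v u" using w unfolding mat_image_def by auto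
      have wc: "w \<in> carrier_vec n" and Pv: "?P *\<^sub>v v \<in> carrier_vec n"
        unfolding wu using c u v by (auto intro: mult_mat_vec_carrier)
      have "?P *\<^sub>v w = w" unfolding wu using assoc_mult_mat_vec[OF c(3) c(1) u] PM by simp
      then have "(?P *\<^sub>v v) \<bullet>c w = v \<bullet>c w" using hermitian_cscalar[OF hP v wc] by simp
      then show ?thesis using v wc Pv by (simp add: minus_scalar_prod_distrib[of _ n])
    qed
    ultimately show ?thesis unfolding is_orth_proj_def using c by blast
  qed
  moreover have "?N *\<^sub>v w = 0\<^sub>v n" if w: "w \<in> carrier_vec n" and z: "\<forall>u\<in>mat_image n M. w \<bullet>c u = 0" for w
  proof -
    have Mw: "M *\<^sub>v w \<in> carrier_vec n" by (rule mult_mat_vec_carrier[OF c(1) w])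
    have "(M *\<^sub>v w) \<bullet>c (M *\<^sub>v w) = w \<bullet>c (M *\<^sub>v (M *\<^sub>v w))" by (rule hermitian_cscalar[OF hM w Mw])
    also have "\<dots> = 0" using z Mw unfolding mat_image_def by blast
    finally have Mw0: "M *\<^sub>v w = 0\<^sub>v n" using conjugate_square_eq_0_vec[OF Mw] by simp
    \<comment> \<open>\<open>?N\<close> absorbs the support projection \<open>?P = ?I * M\<close>,
      so it factors through \<open>M\<close> and inherits the kernel of \<open>M\<close>.\<close>
    have "?N *\<^sub>v w = (?N * ?I * M) *\<^sub>v w" using NP IM c by (simp add: square_mat_mult_assoc[of _ n])
    also have "\<dots> = (?N * ?I) *\<^sub>v (M *\<^sub>v w)" by (rule assoc_mult_mat_vec[of _ n n _ n]) (use c w in auto)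
    also have "\<dots> = 0\<^sub>v n" unfolding Mw0 by (rule mult_mat_vec_zero) (use c in auto)
    finally show ?thesis .
  qed
  ultimately show ?thesis unfolding is_inv_sqrt_def NN IM by blast
qed

text \<open>The difference of two projections of the same vector lies in the image and is orthogonal
  to it, hence to itself.\<close>

lemma is_orth_proj_mat_image_unique:
  assumes M: "M \<in> carrier_mat n n" and P: "is_orth_proj n P (mat_image n M)" and R: "is_orth_proj n R (mat_image n M)"
  shows "P = R"
proof (rule mat_eqI_mult_vec)
  show c: "P \<in> carrier_mat n n" "R \<in> carrier_mat n n" using P R by (auto simp: is_orth_proj_def)
  fix v :: "complex vec" assume v: "v \<in> carrier_vec n"
  define p r where "p = P *\<^sub>v v" and "r = R *\<^sub>v v"
  have pr: "p \<in> carrier_vec n" "r \<in> carrier_vec n" unfolding p_def r_def using c v by (auto intro: mult_mat_vec_carrier)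
  obtain a b where a: "a \<in> carrier_vec n" "p = M *\<^sub>v a" and b: "b \<in> carrier_vec n" "r = M *\<^sub>v b"
    using P R v unfolding is_orth_proj_def mat_image_def p_def r_def by blast
  have ab: "a - b \<in> carrier_vec n" using a b by simp
  have "p - r = M *\<^sub>v (a - b)"
    using a b M by (simp add: mult_minus_distrib_mat_vec[of _ n n])
  then have w: "p - r \<in> mat_image n M" unfolding mat_image_def using ab by blast
  have "(v - p) \<bullet>c (p - r) = 0" "(v - r) \<bullet>c (p - r) = 0"
    using P R v w unfolding is_orth_proj_def p_def r_def by auto
  then have "(p - r) \<bullet>c (p - r) = 0"
    using v pr by (simp add: minus_scalar_prod_distrib[of _ n])
  then have "p - r = 0\<^sub>v n" using pr conjugate_square_eq_0_vec[of "p - r" n] by simp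
  then show "P *\<^sub>v v = R *\<^sub>v v"
    unfolding p_def[symmetric] r_def[symmetric] by (rule vec_diff_eq_zero[OF pr])
qed

text \<open>For any candidate \<open>K\<close>, vanishing on the orthogonal complement gives K P = K
  with P the support projection. Then K K = K K M I = P I = I, where I is the pseudo-inverse of
  \<open>M\<close>, and positive square roots are unique.\<close>

lemma inv_sqrt_mat_eq:
  assumes M: "psd n M"
  shows "inv_sqrt_mat n M = mat_fun n (\<lambda>x. inverse (sqrt \<bar>x\<bar>)) M"
  unfolding inv_sqrt_mat_def
proof (rule the_equality, rule is_inv_sqrt_mat_fun[OF M])
  fix K assume K: "is_inv_sqrt n M K"
  let ?N = "mat_fun n (\<lambda>x. inverse (sqrt \<bar>x\<bar>)) M"
  let ?P = "mat_fun n (\<lambda>x. if x = 0 then 0 else 1) M"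
  let ?I = "mat_fun n inverse M"
  have hM: "hermitian n M" using M by (rule psd_hermitian)
  have Kp: "psd n K" using K by (simp add: is_inv_sqrt_def)
  have c: "M \<in> carrier_mat n n" "?N \<in> carrier_mat n n" "?P \<in> carrier_mat n n" "?I \<in> carrier_mat n n"
    "K \<in> carrier_mat n n"
    using M hM Kp by (auto simp: psd_carrier)
  have NN: "?N * ?N = ?I" by (rule mat_fun_mult_psd[OF M]) (simp flip: inverse_mult_distrib)
  have IM: "?I * M = ?P" "M * ?I = ?P" by (rule mat_fun_mult_self_psd[OF M]; simp)+
  have PI: "?P * ?I = ?I" by (rule mat_fun_mult_psd[OF M]) simp
  have o: "is_orth_proj n ?P (mat_image n M)"
    using is_inv_sqrt_mat_fun[OF M] unfolding is_inv_sqrt_def NN IM by blast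
  have KKM: "K * K * M = ?P"
    by (rule is_orth_proj_mat_image_unique[OF c(1) _ o]) (use K in \<open>simp add: is_inv_sqrt_def\<close>)
  have KP: "K * ?P = K"
  proof (rule mat_eqI_mult_vec)
    fix v :: "complex vec" assume v: "v \<in> carrier_vec n"
    have Pv: "?P *\<^sub>v v \<in> carrier_vec n" by (rule mult_mat_vec_carrier[OF c(3) v])
    have "\<forall>u\<in>mat_image n M. (v - ?P *\<^sub>v v) \<bullet>c u = 0"
      using o v unfolding is_orth_proj_def by blast
    then have "K *\<^sub>v (v - ?P *\<^sub>v v) = 0\<^sub>v n"
      using K v Pv unfolding is_inv_sqrt_def by simp
    then have "K *\<^sub>v v - K *\<^sub>v (?P *\<^sub>v v) = 0\<^sub>v n"
      using mult_minus_distrib_mat_vec[OF c(5) v Pv] by simp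
    moreover have "K *\<^sub>v v \<in> carrier_vec n" "K *\<^sub>v (?P *\<^sub>v v) \<in> carrier_vec n"
      using c(5) v Pv by (auto intro: mult_mat_vec_carrier)
    ultimately have "K *\<^sub>v v = K *\<^sub>v (?P *\<^sub>v v)" by (rule vec_diff_eq_zero[rotated 2])
    then show "K * ?P *\<^sub>v v = K *\<^sub>v v" using assoc_mult_mat_vec[OF c(5) c(3) v] by simp
  qed (use c in auto)
  have "K * K = K * (K * ?P)" using KP by simp
  also have "\<dots> = K * K * M * ?I"
    using c IM by (simp add: square_mat_mult_assoc[of _ n])
  also have "\<dots> = ?I" unfolding KKM by (rule PI)
  finally have KK: "K * K = ?I" .
  have hK: "hermitian n K" using Kp by (rule psd_hermitian)
  \<comment> \<open>Uniqueness of the positive root: \<open>K\<close> is the function sqrt of its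
    own square, and that square is already a function of \<open>M\<close>.\<close>
  have "K = mat_fun n (\<lambda>x. sqrt (x * x)) K"
    by (rule mat_fun_eq_self_psd[OF Kp, symmetric]) simp
  also have "\<dots> = mat_fun n sqrt (mat_fun n (\<lambda>x. x * x) K)"
    by (rule mat_fun_comp[OF hK, symmetric])
  also have "mat_fun n (\<lambda>x. x * x) K = ?I"
    using mat_fun_mult[OF hK, of "\<lambda>x. x" "\<lambda>x. x"] mat_fun_id[OF hK] KK by simp
  also have "mat_fun n sqrt ?I = mat_fun n (\<lambda>x. sqrt (inverse x)) M"
    by (rule mat_fun_comp[OF hM])
  also have "\<dots> = ?N"
    by (rule mat_fun_cong_psd[OF M]) (simp add: real_sqrt_inverse)
  finally show "K = ?N" .
qed

section \<open>Traces and sums\<close>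

lemma sum_mat_carrier [simp]: "sum_mat n A I \<in> carrier_mat n n"
  by (simp add: sum_mat_def)

lemma sum_mat_index [simp]: "i < n \<Longrightarrow> j < n \<Longrightarrow> sum_mat n A I $$ (i, j) = (\<Sum>k\<in>I. A k $$ (i, j))"
  by (simp add: sum_mat_def)

lemma sum_mat_dim [simp]: "dim_row (sum_mat n A I) = n" "dim_col (sum_mat n A I) = n"
  by (simp_all add: sum_mat_def)

lemma sum_mat_mult_right:
  assumes "X \<in> carrier_mat n n" "\<And>i. i \<in> I \<Longrightarrow> A i \<in> carrier_mat n n"
  shows "sum_mat n A I * X = sum_mat n (\<lambda>i. A i * X) I"
proof (rule eq_matI)
  fix i j assume "i < dim_row (sum_mat n (\<lambda>i. A i * X) I)" "j < dim_col (sum_mat n (\<lambda>i. A i * X) I)"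
  then have ij: "i < n" "j < n" by auto
  have "(sum_mat n A I * X) $$ (i, j) = (\<Sum>l<n. \<Sum>k\<in>I. A k $$ (i, l) * X $$ (l, j))"
    using ij assms(1) by (simp add: scalar_prod_def sum_distrib_right atLeast0LessThan)
  also have "\<dots> = (\<Sum>k\<in>I. \<Sum>l<n. A k $$ (i, l) * X $$ (l, j))" by (rule sum.swap)
  also have "\<dots> = (\<Sum>k\<in>I. (A k * X) $$ (i, j))"
    using ij assms by (intro sum.cong) (auto simp: scalar_prod_def atLeast0LessThan dest!: assms(2))
  finally show "(sum_mat n A I * X) $$ (i, j) = sum_mat n (\<lambda>i. A i * X) I $$ (i, j)" using ij by simp
qed (use assms in auto)

lemma sum_mat_mult_left:
  assumes "X \<in> carrier_mat n n" "\<And>i. i \<in> I \<Longrightarrow> A i \<in> carrier_mat n n"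
  shows "X * sum_mat n A I = sum_mat n (\<lambda>i. X * A i) I"
proof (rule eq_matI)
  fix i j assume "i < dim_row (sum_mat n (\<lambda>i. X * A i) I)" "j < dim_col (sum_mat n (\<lambda>i. X * A i) I)"
  then have ij: "i < n" "j < n" by auto
  have "(X * sum_mat n A I) $$ (i, j) = (\<Sum>l<n. \<Sum>k\<in>I. X $$ (i, l) * A k $$ (l, j))"
    using ij assms(1) by (simp add: scalar_prod_def sum_distrib_left atLeast0LessThan)
  also have "\<dots> = (\<Sum>k\<in>I. \<Sum>l<n. X $$ (i, l) * A k $$ (l, j))" by (rule sum.swap)
  also have "\<dots> = (\<Sum>k\<in>I. (X * A k) $$ (i, j))"
    using ij assms by (intro sum.cong) (auto simp: scalar_prod_def atLeast0LessThan dest!: assms(2))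
  finally show "(X * sum_mat n A I) $$ (i, j) = sum_mat n (\<lambda>i. X * A i) I $$ (i, j)" using ij by simp
qed (use assms in auto)

lemma sum_mat_cong:
  assumes "\<And>i. i \<in> I \<Longrightarrow> A i = B i"
  shows "sum_mat n A I = sum_mat n B I"
  unfolding sum_mat_def using assms by (intro eq_matI) auto

lemma sum_mat_form:
  assumes "\<And>i. i \<in> I \<Longrightarrow> A i \<in> carrier_mat n n" "v \<in> carrier_vec n"
  shows "(sum_mat n A I *\<^sub>v v) \<bullet>c v = (\<Sum>i\<in>I. (A i *\<^sub>v v) \<bullet>c v)"
proof -
  have "(sum_mat n A I *\<^sub>v v) \<bullet>c v = (\<Sum>r<n. \<Sum>l<n. \<Sum>k\<in>I. A k $$ (r, l) * v $ l * cnj (v $ r))"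
    using assms(2) by (simp add: scalar_prod_def sum_distrib_right atLeast0LessThan)
  also have "\<dots> = (\<Sum>r<n. \<Sum>k\<in>I. \<Sum>l<n. A k $$ (r, l) * v $ l * cnj (v $ r))"
    by (intro sum.cong refl) (rule sum.swap)
  also have "\<dots> = (\<Sum>k\<in>I. \<Sum>r<n. \<Sum>l<n. A k $$ (r, l) * v $ l * cnj (v $ r))" by (rule sum.swap)
  also have "\<dots> = (\<Sum>i\<in>I. (A i *\<^sub>v v) \<bullet>c v)"
    using assms by (intro sum.cong) (auto simp: scalar_prod_def sum_distrib_right atLeast0LessThan dest!: assms(1))
  finally show ?thesis .
qed

lemma psd_sum_mat:
  assumes "\<And>i. i \<in> I \<Longrightarrow> psd n (A i)"
  shows "psd n (sum_mat n A I)"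
  unfolding psd_def
proof (intro conjI ballI)
  fix v :: "complex vec" assume v: "v \<in> carrier_vec n"
  have "(sum_mat n A I *\<^sub>v v) \<bullet>c v = (\<Sum>i\<in>I. (A i *\<^sub>v v) \<bullet>c v)"
    by (rule sum_mat_form) (use assms v in \<open>auto simp: psd_carrier\<close>)
  also have "0 \<le> \<dots>" by (rule sum_nonneg) (use assms v in \<open>auto simp: psd_def\<close>)
  finally show "0 \<le> (sum_mat n A I *\<^sub>v v) \<bullet>c v" .
qed simp

lemma trace_mat_mult_commute:
  assumes "A \<in> carrier_mat n n" "B \<in> carrier_mat n n"
  shows "trace_mat (A * B) = trace_mat (B * A)"
proof -
  have "trace_mat (A * B) = (\<Sum>i<n. \<Sum>j<n. A $$ (i, j) * B $$ (j, i))"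
    using assms by (simp add: trace_mat_def scalar_prod_def atLeast0LessThan)
  also have "\<dots> = (\<Sum>j<n. \<Sum>i<n. A $$ (i, j) * B $$ (j, i))" by (rule sum.swap)
  also have "\<dots> = trace_mat (B * A)"
    using assms by (simp add: trace_mat_def scalar_prod_def atLeast0LessThan mult.commute)
  finally show ?thesis .
qed

lemma trace_mat_sum_mat:
  assumes "\<And>i. i \<in> I \<Longrightarrow> A i \<in> carrier_mat n n"
  shows "trace_mat (sum_mat n A I) = (\<Sum>i\<in>I. trace_mat (A i))"
proof -
  have "trace_mat (sum_mat n A I) = (\<Sum>i\<in>I. \<Sum>r<n. A i $$ (r, r))"
    unfolding trace_mat_def by simp (rule sum.swap)
  also have "\<dots> = (\<Sum>i\<in>I. trace_mat (A i))"
    unfolding trace_mat_def using assms by (intro sum.cong) (auto dest!: assms)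
  finally show ?thesis .
qed

lemma trace_mat_diff:
  assumes "A \<in> carrier_mat n n" "B \<in> carrier_mat n n"
  shows "trace_mat (A - B) = trace_mat A - trace_mat B"
  using assms by (simp add: trace_mat_def sum_subtractf)

lemma trace_psd_nonneg:
  assumes "psd n A"
  shows "0 \<le> Re (trace_mat A)"
proof -
  have A: "A \<in> carrier_mat n n" using assms by (rule psd_carrier)
  have "0 \<le> Re (A $$ (i, i))" if i: "i < n" for i
  proof -
    have "0 \<le> (A *\<^sub>v unit_vec n i) \<bullet>c unit_vec n i" using assms i unfolding psd_def by auto
    also have "(A *\<^sub>v unit_vec n i) \<bullet>c unit_vec n i = A $$ (i, i)"
      using A i by (simp add: mat_mult_unit_vec scalar_prod_def unit_vec_def if_distrib[of cnj] if_distrib[of "(*) _"] cong: if_cong)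
    finally show ?thesis by (simp add: less_eq_complex_def)
  qed
  then show ?thesis using A by (auto simp: trace_mat_def intro!: sum_nonneg)
qed

text \<open>Cyclicity turns the trace of A B into that of S B S, with S the square root of
  \<open>A\<close>. The product A B itself need not be positive.\<close>

lemma trace_psd_mult_nonneg:
  assumes A: "psd n A" and B: "psd n B"
  shows "0 \<le> Re (trace_mat (A * B))"
proof -
  let ?S = "mat_fun n sqrt A"
  have hA: "hermitian n A" using A by (rule psd_hermitian)
  have c: "A \<in> carrier_mat n n" "B \<in> carrier_mat n n" "?S \<in> carrier_mat n n"
    using A B hA by (auto simp: psd_carrier)
  have hS: "mat_adjoint ?S = ?S" using mat_fun_hermitian[OF hA, of sqrt] by (simp add: hermitian_def)
  have SS: "?S * ?S = A"
    using mat_fun_mult_psd[OF A, of sqrt sqrt "\<lambda>x. x"] mat_fun_id[OF hA] by simp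
  have "A * B = ?S * (?S * B)" using SS c by (simp add: square_mat_mult_assoc[of _ n, symmetric])
  then have "trace_mat (A * B) = trace_mat (?S * B * ?S)"
    using trace_mat_mult_commute[of ?S n "?S * B"] c by simp
  then show ?thesis using trace_psd_nonneg[OF psd_conj[OF B c(3)]] hS by simp
qed

section \<open>Optimality of the pretty good measurement\<close>

text \<open>Cancelling one factor \<open>X\<close> on its support gives X = C E with E the support
  projection of \<open>X\<close>. So C - X = C F for the complementary projection F, a product of
  commuting positive matrices.\<close>

lemma psd_diff_of_square:
  assumes C: "psd n C" and X: "psd n X" and CX: "C * X = X * C" and XX: "X * X = C * X"
  shows "psd n (C - X)"
proof -
  let ?E = "mat_fun n (\<lambda>x. if x = 0 then 0 else 1) X" and ?I = "mat_fun n inverse X"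
  let ?F = "mat_fun n (\<lambda>x. if x = 0 then 1 else 0) X"
  have hX: "hermitian n X" using X by (rule psd_hermitian)
  have c: "C \<in> carrier_mat n n" "X \<in> carrier_mat n n" "?E \<in> carrier_mat n n" "?I \<in> carrier_mat n n" "?F \<in> carrier_mat n n"
    using C X hX by (auto simp: psd_carrier)
  have XI: "X * ?I = ?E" by (rule mat_fun_mult_self_psd[OF X]) simp
  have XE: "X * ?E = X"
    using mat_fun_mult_self_psd(2)[OF X, of "\<lambda>x. if x = 0 then 0 else 1" "\<lambda>x. x"] mat_fun_id[OF hX] by simp
  have "X = X * X * ?I" using XE XI c by (simp add: square_mat_mult_assoc[of _ n])
  also have "\<dots> = C * ?E" unfolding XX using XI c by (simp add: square_mat_mult_assoc[of _ n])
  finally have XCE: "X = C * ?E" .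
  have one: "C = C * ?E + C * ?F"
  proof -
    obtain P Q d where D: "diagonalizes n P Q d X" using hermitian_diagonalizable[OF hX] .
    have PQ: "P \<in> carrier_mat n n" "Q \<in> carrier_mat n n" "P * Q = 1\<^sub>m n" using D unfolding diagonalizes_def by auto
    have "?E + ?F = P * (mat_diag n (\<lambda>i. complex_of_real (if d i = 0 then 0 else 1)) + mat_diag n (\<lambda>i. complex_of_real (if d i = 0 then 1 else 0))) * Q"
      unfolding mat_fun_eq[OF D] using PQ
      by (simp add: mult_add_distrib_mat[of _ n n _ n] add_mult_distrib_mat[of _ n n _ _ n])
    also have "mat_diag n (\<lambda>i. complex_of_real (if d i = 0 then 0 else 1)) + mat_diag n (\<lambda>i. complex_of_real (if d i = 0 then 1 else 0)) = 1\<^sub>m n"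
      by (intro eq_matI) (auto simp: mat_diag_def)
    finally have "?E + ?F = 1\<^sub>m n" using PQ by simp
    then have "C * (?E + ?F) = C" using c by simp
    then show ?thesis using c by (simp add: mult_add_distrib_mat[of _ n n _ n])
  qed
  have "C - X = C * ?F"
    by (subst XCE, subst one) (use c in \<open>auto intro!: eq_matI\<close>)
  moreover have "psd n ?F" by (rule mat_fun_psd[OF hX]) simp
  moreover have "C * ?F = ?F * C" by (rule mat_fun_commute[OF hX c(1) CX])
  ultimately show ?thesis using psd_mult_commute[OF C] by simp
qed

text \<open>A vector killed by the sum makes a sum of nonnegative forms zero, so every summand kills
  it as well. The vectors w = v - P v are of this kind.\<close>

lemma psd_summand_mult_support:
  assumes A: "\<And>i. i \<in> I \<Longrightarrow> psd n (A i)" and fin: "finite I" and i: "i \<in> I"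
  shows "A i * mat_fun n (\<lambda>x. if x = 0 then 0 else 1) (sum_mat n A I) = A i"
proof -
  define M where "M = sum_mat n A I"
  define P where "P = mat_fun n (\<lambda>x. if x = 0 then 0 else 1) M"
  have Mp: "psd n M" unfolding M_def using A by (rule psd_sum_mat)
  have hM: "hermitian n M" using Mp by (rule psd_hermitian)
  have c: "M \<in> carrier_mat n n" "P \<in> carrier_mat n n"
    unfolding P_def using hM Mp by (auto simp: psd_carrier)
  have cA: "A i \<in> carrier_mat n n" if "i \<in> I" for i using A[OF that] by (rule psd_carrier)
  have MP: "M * P = M" unfolding P_def
    using mat_fun_mult_self_psd(2)[OF Mp, of "\<lambda>x. if x = 0 then 0 else 1" "\<lambda>x. x"] mat_fun_id[OF hM] by simp
  have "A i * P = A i"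
  proof (rule mat_eqI_mult_vec)
    fix v :: "complex vec" assume v: "v \<in> carrier_vec n"
    have Pv: "P *\<^sub>v v \<in> carrier_vec n" by (rule mult_mat_vec_carrier[OF c(2) v])
    define w where "w = v - P *\<^sub>v v"
    have w: "w \<in> carrier_vec n" using v Pv by (simp add: w_def)
    have "M *\<^sub>v w = M *\<^sub>v v - (M * P) *\<^sub>v v"
      unfolding w_def assoc_mult_mat_vec[OF c(1) c(2) v] by (rule mult_minus_distrib_mat_vec[OF c(1) v Pv])
    then have "M *\<^sub>v w = 0\<^sub>v n" using MP mult_mat_vec_carrier[OF c(1) v] by simp
    then have "(\<Sum>i\<in>I. (A i *\<^sub>v w) \<bullet>c w) = 0"
      using sum_mat_form[of I A n w, OF cA w] w unfolding M_def by simp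
    moreover have "0 \<le> (A i *\<^sub>v w) \<bullet>c w" if "i \<in> I" for i using A[OF that] w unfolding psd_def by auto
    ultimately have "(A i *\<^sub>v w) \<bullet>c w = 0" using sum_nonneg_eq_0_iff[OF fin, of "\<lambda>i. (A i *\<^sub>v w) \<bullet>c w"] i by simp
    then have "A i *\<^sub>v w = 0\<^sub>v n" by (rule psd_form_zero[OF A[OF i] w])
    then have "A i *\<^sub>v v - A i *\<^sub>v (P *\<^sub>v v) = 0\<^sub>v n"
      unfolding w_def mult_minus_distrib_mat_vec[OF cA[OF i] v Pv] .
    then have "A i *\<^sub>v v = A i *\<^sub>v (P *\<^sub>v v)"
      by (rule vec_diff_eq_zero[rotated 2]) (use mult_mat_vec_carrier[OF cA[OF i]] v Pv in auto)
    then show "A i * P *\<^sub>v v = A i *\<^sub>v v" using assoc_mult_mat_vec[OF cA[OF i] c(2) v] by simp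
  qed (use cA[OF i] c in auto)
  then show ?thesis unfolding P_def M_def .
qed

text \<open>The weights are absorbed into \<open>A\<close>, so \<open>N * A i * N\<close> is the
  operator of outcome i. What a measurement loses against the certificate is the trace of
  \<open>F i\<close> against \<open>C * S - A i\<close> for each outcome, plus the trace of the
  extra outcome against \<open>C * S\<close>.\<close>

theorem pretty_good_optimal:
  assumes A: "\<And>i. i \<in> I \<Longrightarrow> psd n (A i)"
    and M: "M = sum_mat n A I" and N: "N = inv_sqrt_mat n M" and fin: "finite I"
    and C: "psd n C" and CA: "\<And>i. i \<in> I \<Longrightarrow> C * A i = A i * C"
    and ANA: "\<And>i. i \<in> I \<Longrightarrow> A i * N * A i = C * A i"
    and F: "measurement n I F"
  shows "(\<Sum>i\<in>I. Re (trace_mat (F i * A i))) \<le> (\<Sum>i\<in>I. Re (trace_mat (N * A i * N * A i)))"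
proof -
  have Mp: "psd n M" unfolding M using A by (rule psd_sum_mat)
  have hM: "hermitian n M" using Mp by (rule psd_hermitian)
  have Nf: "N = mat_fun n (\<lambda>x. inverse (sqrt \<bar>x\<bar>)) M" unfolding N by (rule inv_sqrt_mat_eq[OF Mp])
  define P where "P = mat_fun n (\<lambda>x. if x = 0 then 0 else 1) M"
  \<comment> \<open>\<open>R\<close> and \<open>T\<close> are M^(-1/4) and M^(1/4). They are inverse
    to each other only on the support of \<open>M\<close>, whose projection is
    \<open>P\<close>.\<close>
  define R where "R = mat_fun n (\<lambda>x. inverse (sqrt (sqrt \<bar>x\<bar>))) M"
  define T where "T = mat_fun n (\<lambda>x. sqrt (sqrt \<bar>x\<bar>)) M"
  define S where "S = mat_fun n (\<lambda>x. sqrt \<bar>x\<bar>) M"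
  have c: "M \<in> carrier_mat n n" "N \<in> carrier_mat n n" "P \<in> carrier_mat n n" "R \<in> carrier_mat n n"
      "T \<in> carrier_mat n n" "S \<in> carrier_mat n n" "C \<in> carrier_mat n n"
    unfolding Nf P_def R_def T_def S_def using hM Mp C by (auto simp: psd_carrier)
  have cA: "A i \<in> carrier_mat n n" if "i \<in> I" for i using A[OF that] by (rule psd_carrier)
  have cF: "F i \<in> carrier_mat n n" if "i \<in> I" for i using F that unfolding measurement_def by (auto simp: psd_carrier)
  have RT: "R * T = P" "T * R = P" unfolding R_def T_def P_def by (rule mat_fun_mult_psd[OF Mp]; simp)+
  have RR: "R * R = N" unfolding R_def Nf by (rule mat_fun_mult_psd[OF Mp]) (simp flip: inverse_mult_distrib)
  have TT: "T * T = S" unfolding T_def S_def by (rule mat_fun_mult_psd[OF Mp]) simp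
  have NM: "N * M = S" unfolding Nf S_def
    by (rule mat_fun_mult_self_psd[OF Mp]) (simp add: divide_inverse_commute[symmetric] real_div_sqrt)
  have Sp: "psd n S" unfolding S_def by (rule mat_fun_psd[OF hM]) simp
  have CM: "C * M = M * C"
    unfolding M using CA by (simp add: sum_mat_mult_left[OF c(7) cA] sum_mat_mult_right[OF c(7) cA] cong: sum_mat_cong)
  have comm: "C * R = R * C" "C * T = T * C" "C * S = S * C" "C * N = N * C"
    unfolding R_def T_def S_def Nf by (rule mat_fun_commute[OF hM c(7) CM])+
  have adj: "mat_adjoint R = R" "mat_adjoint T = T" "mat_adjoint P = P"
    using mat_fun_hermitian[OF hM] unfolding R_def T_def P_def hermitian_def by blast+
  have CS: "psd n (C * S)" by (rule psd_mult_commute[OF C Sp comm(3)])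
  have AP: "A i * P = A i" if i: "i \<in> I" for i
    using psd_summand_mult_support[OF A fin i] unfolding P_def M .
  have PA: "P * A i = A i" if i: "i \<in> I" for i
    using arg_cong[OF AP[OF i], of mat_adjoint] mat_adjoint_mult[OF cA[OF i] c(3)] adj
      psd_hermitian[OF A[OF i]] by (simp add: hermitian_def)
  have dom: "psd n (C * S - A i)" if i: "i \<in> I" for i
  proof -
    note ca = cA[OF i]
    define X where "X = R * A i * R"
    have cX: "X \<in> carrier_mat n n" unfolding X_def using ca c by simp
    have Xp: "psd n X" using psd_conj[OF A[OF i] c(4)] adj unfolding X_def by simp
    have RC: "R * (C * Z) = C * (R * Z)" if "Z \<in> carrier_mat n n" for Z
      by (rule square_mat_left_commute[OF comm(1)[symmetric] c(4) c(7) that])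
    have AC: "A i * (C * Z) = C * (A i * Z)" if "Z \<in> carrier_mat n n" for Z
      by (rule square_mat_left_commute[OF CA[OF i, symmetric] ca c(7) that])
    have CX: "C * X = X * C"
      unfolding X_def using c ca by (simp add: square_mat_mult_assoc[of _ n] RC AC comm(1)[symmetric])
    have "X * X = R * (A i * (R * R) * A i) * R"
      unfolding X_def using c ca by (simp add: square_mat_mult_assoc[of _ n])
    also have "\<dots> = R * (C * A i) * R" unfolding RR ANA[OF i] ..
    also have "\<dots> = C * X" unfolding X_def using c ca by (simp add: square_mat_mult_assoc[of _ n] RC)
    finally have XX: "X * X = C * X" .
    have "psd n (T * (C - X) * T)"
      using psd_conj[OF psd_diff_of_square[OF C Xp CX XX] c(5)] adj by simp
    also have "T * (C - X) * T = T * C * T - T * X * T"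
      using c cX by (simp add: mult_minus_distrib_mat[of _ n n _ n] minus_mult_distrib_mat[of _ n n _ _ n])
    \<comment> \<open>Conjugation by \<open>T\<close> undoes that by \<open>R\<close> up to
      \<open>P\<close> on both sides, and \<open>A i\<close> absorbs \<open>P\<close> because its
      support lies in that of \<open>M\<close>.\<close>
    also have "T * X * T = (T * R) * A i * (R * T)"
      unfolding X_def using c ca by (simp add: square_mat_mult_assoc[of _ n])
    also have "\<dots> = A i" unfolding RT using PA[OF i] AP[OF i] by simp
    also have "T * C * T = C * S"
      unfolding comm(2)[symmetric] TT[symmetric] using c by (simp add: square_mat_mult_assoc[of _ n])
    finally show ?thesis .
  qed
  have "(\<Sum>i\<in>I. Re (trace_mat (F i * A i))) \<le> (\<Sum>i\<in>I. Re (trace_mat (F i * (C * S))))"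
  proof (rule sum_mono)
    fix i assume i: "i \<in> I"
    have "0 \<le> Re (trace_mat (F i * (C * S - A i)))"
      by (rule trace_psd_mult_nonneg[OF _ dom[OF i]]) (use F i in \<open>simp add: measurement_def\<close>)
    also have "F i * (C * S - A i) = F i * (C * S) - F i * A i"
      using cF[OF i] cA[OF i] c by (simp add: mult_minus_distrib_mat[of _ n n _ n])
    finally show "Re (trace_mat (F i * A i)) \<le> Re (trace_mat (F i * (C * S)))"
      using cF[OF i] cA[OF i] c by (simp add: trace_mat_diff[of _ n])
  qed
  also have "\<dots> = Re (trace_mat (sum_mat n F I * (C * S)))"
    using cF c by (simp add: sum_mat_mult_right trace_mat_sum_mat)
  \<comment> \<open>Incomplete families cost only the nonnegative contribution of the missing
    operator 1 - sum F.\<close>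
  also have "\<dots> \<le> Re (trace_mat (C * S))"
  proof -
    have "0 \<le> Re (trace_mat ((1\<^sub>m n - sum_mat n F I) * (C * S)))"
      by (rule trace_psd_mult_nonneg[OF _ CS]) (use F in \<open>simp add: measurement_def\<close>)
    also have "(1\<^sub>m n - sum_mat n F I) * (C * S) = C * S - sum_mat n F I * (C * S)"
      using c by (simp add: minus_mult_distrib_mat[of _ n n _ _ n])
    finally show ?thesis using c by (simp add: trace_mat_diff[of _ n])
  qed
  also have "C * S = N * C * M"
    unfolding comm(4)[symmetric] NM[symmetric] using c by (simp add: square_mat_mult_assoc[of _ n])
  also have "\<dots> = sum_mat n (\<lambda>i. N * C * A i) I"
    unfolding M using c cA by (simp add: sum_mat_mult_left)
  also have "Re (trace_mat \<dots>) = (\<Sum>i\<in>I. Re (trace_mat (N * C * A i)))"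
    using c cA by (simp add: trace_mat_sum_mat)
  also have "\<dots> = (\<Sum>i\<in>I. Re (trace_mat (N * A i * N * A i)))"
  proof (rule sum.cong[OF refl])
    fix i assume i: "i \<in> I"
    have "N * A i * N * A i = N * (A i * N * A i)" using c cA[OF i] by (simp add: square_mat_mult_assoc[of _ n])
    then show "Re (trace_mat (N * C * A i)) = Re (trace_mat (N * A i * N * A i))"
      using c cA[OF i] ANA[OF i] by (simp add: square_mat_mult_assoc[of _ n])
  qed
  finally show ?thesis .
qed

section \<open>Convolution matrices\<close>

locale enumerated_group = group K for K (structure) +
  fixes n :: nat and b :: "nat \<Rightarrow> 'a"
  assumes enum: "bij_betw b {..<n} (carrier K)"
begin

text \<open>As an operator on the group algebra it sends |y> to the sum of f u |y u^-1> over u; the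
  row and column numbers stand for group elements through \<open>b\<close>. In particular
  \<open>trans_mat u\<close> is |y> to |y u^-1>, the right regular representation, and is
  multiplicative in \<open>u\<close>.\<close>

definition conv_mat :: "('a \<Rightarrow> complex) \<Rightarrow> complex mat" where
  "conv_mat f = mat n n (\<lambda>(i, j). f (inv (b i) \<otimes> b j))"

definition trans_mat :: "'a \<Rightarrow> complex mat" where
  "trans_mat u = conv_mat (\<lambda>x. if x = u then 1 else 0)"

lemma finite_carrier: "finite (carrier K)"
  using bij_betw_finite[OF enum] by simp

lemma b_closed [simp]: "i < n \<Longrightarrow> b i \<in> carrier K"
  using enum by (auto simp: bij_betw_def)

lemma enum_surj:
  assumes "x \<in> carrier K"
  obtains i where "i < n" "b i = x"
  using enum assms by (force simp: bij_betw_def)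

lemma enum_inj: "i < n \<Longrightarrow> j < n \<Longrightarrow> b i = b j \<Longrightarrow> i = j"
  using enum by (auto simp: bij_betw_def inj_on_def)

lemma conv_mat_carrier [simp]: "conv_mat f \<in> carrier_mat n n"
  by (simp add: conv_mat_def)

lemma conv_mat_dim [simp]: "dim_row (conv_mat f) = n" "dim_col (conv_mat f) = n"
  by (simp_all add: conv_mat_def)

lemma conv_mat_index [simp]:
  "i < n \<Longrightarrow> j < n \<Longrightarrow> conv_mat f $$ (i, j) = f (inv (b i) \<otimes> b j)"
  by (simp add: conv_mat_def)

lemma trans_mat_carrier [simp]: "trans_mat u \<in> carrier_mat n n"
  by (simp add: trans_mat_def)

lemma conv_mat_cong: "(\<And>x. x \<in> carrier K \<Longrightarrow> f x = f' x) \<Longrightarrow> conv_mat f = conv_mat f'"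
  by (intro eq_matI) auto

lemma conv_mat_inj:
  assumes "conv_mat f = conv_mat f'" "x \<in> carrier K"
  shows "f x = f' x"
proof -
  obtain i j where "i < n" "b i = \<one>" "j < n" "b j = x"
    using enum_surj assms(2) one_closed by metis
  then show ?thesis using arg_cong[OF assms(1), of "\<lambda>X. X $$ (i, j)"] assms(2) by simp
qed

lemma sum_translate:
  assumes "u \<in> carrier K"
  shows "(\<Sum>y\<in>carrier K. g (u \<otimes> y)) = (\<Sum>y\<in>carrier K. g y)"
  by (rule sum.reindex_bij_witness[of _ "\<lambda>y. inv u \<otimes> y" "\<lambda>y. u \<otimes> y"])
    (use assms in \<open>auto simp: m_assoc[symmetric]\<close>)

lemma conv_mat_mult: "conv_mat f * conv_mat f' = conv_mat (convolution K f f')"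
proof (rule eq_matI)
  fix i j assume "i < dim_row (conv_mat (convolution K f f'))" "j < dim_col (conv_mat (convolution K f f'))"
  then have ij: "i < n" "j < n" by auto
  have "(conv_mat f * conv_mat f') $$ (i, j) = (\<Sum>l<n. f (inv (b i) \<otimes> b l) * f' (inv (b l) \<otimes> b j))"
    using ij by (simp add: scalar_prod_def atLeast0LessThan)
  also have "\<dots> = (\<Sum>y\<in>carrier K. f (inv (b i) \<otimes> y) * f' (inv y \<otimes> b j))"
    by (rule sum.reindex_bij_betw[OF enum])
  also have "\<dots> = (\<Sum>y\<in>carrier K. f (inv (b i) \<otimes> (b i \<otimes> y)) * f' (inv (b i \<otimes> y) \<otimes> b j))"
    using sum_translate[of "b i" "\<lambda>y. f (inv (b i) \<otimes> y) * f' (inv y \<otimes> b j)"] ij by simp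
  also have "\<dots> = convolution K f f' (inv (b i) \<otimes> b j)"
    unfolding convolution_def using ij
    by (intro sum.cong refl) (simp add: inv_mult_group m_assoc[symmetric])
  finally show "(conv_mat f * conv_mat f') $$ (i, j) = conv_mat (convolution K f f') $$ (i, j)"
    using ij by simp
qed auto

lemma trans_mat_mult_conv_mat:
  assumes u: "u \<in> carrier K"
  shows "trans_mat u * conv_mat f = conv_mat (\<lambda>x. f (inv u \<otimes> x))"
  unfolding trans_mat_def conv_mat_mult convolution_def
proof (rule conv_mat_cong)
  fix x assume "x \<in> carrier K"
  have "(\<Sum>y\<in>carrier K. (if y = u then 1 else 0) * f (inv y \<otimes> x)) =
      (\<Sum>y\<in>carrier K. if y = u then f (inv u \<otimes> x) else 0)"
    by (intro sum.cong) auto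
  then show "(\<Sum>y\<in>carrier K. (if y = u then 1 else 0) * f (inv y \<otimes> x)) = f (inv u \<otimes> x)"
    using u finite_carrier by simp
qed

lemma conv_mat_mult_trans_mat:
  assumes u: "u \<in> carrier K"
  shows "conv_mat f * trans_mat u = conv_mat (\<lambda>x. f (x \<otimes> inv u))"
  unfolding trans_mat_def conv_mat_mult convolution_def
proof (rule conv_mat_cong)
  fix x assume x: "x \<in> carrier K"
  have "inv y \<otimes> x = u \<longleftrightarrow> y = x \<otimes> inv u" if "y \<in> carrier K" for y
    using x u that by (metis inv_closed inv_inv inv_mult_group m_closed inv_solve_left' inv_solve_right' m_assoc l_inv r_inv r_one l_one)
  then have "(\<Sum>y\<in>carrier K. f y * (if inv y \<otimes> x = u then 1 else 0)) =
      (\<Sum>y\<in>carrier K. if y = x \<otimes> inv u then f (x \<otimes> inv u) else 0)"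
    by (intro sum.cong) auto
  then show "(\<Sum>y\<in>carrier K. f y * (if inv y \<otimes> x = u then 1 else 0)) = f (x \<otimes> inv u)"
    using x u finite_carrier by simp
qed

lemma trans_mat_mult:
  assumes "u \<in> carrier K" "v \<in> carrier K"
  shows "trans_mat u * trans_mat v = trans_mat (u \<otimes> v)"
proof -
  have "inv u \<otimes> x = v \<longleftrightarrow> x = u \<otimes> v" if "x \<in> carrier K" for x
    using assms that inv_solve_left' by metis
  then show ?thesis
    using assms unfolding trans_mat_mult_conv_mat[OF assms(1), of "\<lambda>x. if x = v then 1 else 0", folded trans_mat_def]
    unfolding trans_mat_def by (intro conv_mat_cong) auto
qed

lemma trans_mat_one: "trans_mat \<one> = 1\<^sub>m n"
proof (rule eq_matI)
  fix i j assume "i < dim_row (1\<^sub>m n :: complex mat)" "j < dim_col (1\<^sub>m n :: complex mat)"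
  then have ij: "i < n" "j < n" by auto
  have "inv (b i) \<otimes> b j = \<one> \<longleftrightarrow> i = j"
    using ij enum_inj[of i j] by (metis b_closed inv_solve_left' one_closed r_one l_inv)
  then show "trans_mat \<one> $$ (i, j) = 1\<^sub>m n $$ (i, j)"
    using ij by (auto simp: trans_mat_def)
qed (auto simp: trans_mat_def)

lemma trans_mat_inv:
  assumes "u \<in> carrier K"
  shows "trans_mat u * trans_mat (inv u) = 1\<^sub>m n" "trans_mat (inv u) * trans_mat u = 1\<^sub>m n"
  using assms by (simp_all add: trans_mat_mult trans_mat_one)

lemma mat_adjoint_conv_mat: "mat_adjoint (conv_mat f) = conv_mat (\<lambda>x. cnj (f (inv x)))"
  by (rule eq_matI) (auto simp: inv_mult_group)

lemma mat_adjoint_trans_mat: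
  assumes "u \<in> carrier K"
  shows "mat_adjoint (trans_mat u) = trans_mat (inv u)"
  unfolding trans_mat_def mat_adjoint_conv_mat
  using assms by (intro conv_mat_cong) auto

lemma conv_mat_expansion:
  "conv_mat f = sum_mat n (\<lambda>u. f u \<cdot>\<^sub>m trans_mat u) (carrier K)"
proof (rule eq_matI)
  fix i j assume "i < dim_row (sum_mat n (\<lambda>u. f u \<cdot>\<^sub>m trans_mat u) (carrier K))"
    "j < dim_col (sum_mat n (\<lambda>u. f u \<cdot>\<^sub>m trans_mat u) (carrier K))"
  then have ij: "i < n" "j < n" by auto
  have "(\<Sum>u\<in>carrier K. (f u \<cdot>\<^sub>m trans_mat u) $$ (i, j)) =
      (\<Sum>u\<in>carrier K. if u = inv (b i) \<otimes> b j then f u else 0)"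
    using ij by (intro sum.cong refl) (auto simp: trans_mat_def)
  then show "conv_mat f $$ (i, j) = sum_mat n (\<lambda>u. f u \<cdot>\<^sub>m trans_mat u) (carrier K) $$ (i, j)"
    using ij finite_carrier by simp
qed auto

lemma commute_conv_mat:
  assumes X: "X \<in> carrier_mat n n" and XR: "\<And>u. u \<in> carrier K \<Longrightarrow> X * trans_mat u = trans_mat u * X"
  shows "X * conv_mat f = conv_mat f * X"
  unfolding conv_mat_expansion using X XR
  by (simp add: sum_mat_mult_left[OF X] sum_mat_mult_right[OF X] mult_smult_distrib[of _ n n _ n]
 mult_smult_assoc_mat[of _ n n _ n] cong: sum_mat_cong)

section \<open>Left translations and their commutant\<close>

definition left_mat :: "'a \<Rightarrow> complex mat" where
  "left_mat w = mat n n (\<lambda>(i, j). if b i = w \<otimes> b j then 1 else 0)"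

lemma left_mat_carrier [simp]: "left_mat w \<in> carrier_mat n n"
  by (simp add: left_mat_def)

lemma left_mat_mult_index:
  assumes X: "X \<in> carrier_mat n n" and w: "w \<in> carrier K" and ij: "i < n" "j < n" and l: "l < n" "b i = w \<otimes> b l"
  shows "(left_mat w * X) $$ (i, j) = X $$ (l, j)"
proof -
  have "b i = w \<otimes> b m \<longleftrightarrow> m = l" if "m < n" for m
    using l enum_inj[OF that l(1)] w that by auto
  then have "(left_mat w * X) $$ (i, j) = (\<Sum>m<n. if m = l then X $$ (l, j) else 0)"
    using X ij by (auto simp: left_mat_def scalar_prod_def atLeast0LessThan if_distrib[where f = "\<lambda>t. t * _"] if_distrib[where f = "(*) _"] cong: if_cong intro!: sum.cong)
  then show ?thesis using l by simp
qed

lemma mult_left_mat_index: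
  assumes X: "X \<in> carrier_mat n n" and w: "w \<in> carrier K" and ij: "i < n" "j < n" and l: "l < n" "b l = w \<otimes> b j"
  shows "(X * left_mat w) $$ (i, j) = X $$ (i, l)"
proof -
  have "b m = w \<otimes> b j \<longleftrightarrow> m = l" if "m < n" for m
    using l enum_inj[OF that l(1)] w that by auto
  then have "(X * left_mat w) $$ (i, j) = (\<Sum>m<n. if m = l then X $$ (i, l) else 0)"
    using X ij by (auto simp: left_mat_def scalar_prod_def atLeast0LessThan if_distrib[where f = "\<lambda>t. t * _"] if_distrib[where f = "(*) _"] cong: if_cong intro!: sum.cong)
  then show ?thesis using l by simp
qed

lemma left_mat_commute_conv_mat:
  assumes w: "w \<in> carrier K"
  shows "left_mat w * conv_mat f = conv_mat f * left_mat w"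
proof (rule eq_matI)
  fix i j assume "i < dim_row (conv_mat f * left_mat w)" "j < dim_col (conv_mat f * left_mat w)"
  then have ij: "i < n" "j < n" by (auto simp: left_mat_def)
  obtain l where l: "l < n" "b l = inv w \<otimes> b i" using enum_surj[of "inv w \<otimes> b i"] w ij by auto
  obtain m where m: "m < n" "b m = w \<otimes> b j" using enum_surj[of "w \<otimes> b j"] w ij by auto
  have bi: "b i = w \<otimes> b l" using l w ij by (simp add: m_assoc[symmetric])
  have "inv (b l) \<otimes> b j = inv (b i) \<otimes> b m"
    using l m w ij by (simp add: inv_mult_group m_assoc)
  then show "(left_mat w * conv_mat f) $$ (i, j) = (conv_mat f * left_mat w) $$ (i, j)"
    using left_mat_mult_index[OF conv_mat_carrier w ij l(1) bi] mult_left_mat_index[OF conv_mat_carrier w ij m]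
      ij l m by simp
qed (auto simp: left_mat_def)

text \<open>Translating the row of \<open>b i\<close> back to the row of the unit shows that the
  entry at (x, y) depends only on x^-1 y. The row of the unit is therefore the convolution
  kernel.\<close>

lemma left_invariant_conv_mat:
  assumes X: "X \<in> carrier_mat n n" and comm: "\<And>w. w \<in> carrier K \<Longrightarrow> left_mat w * X = X * left_mat w"
  obtains f where "X = conv_mat f"
proof -
  obtain o1 where o1: "o1 < n" "b o1 = \<one>" using enum_surj[of \<one>] by auto
  define \<iota> where "\<iota> x = (SOME i. i < n \<and> b i = x)" for x
  have \<iota>: "\<iota> x < n \<and> b (\<iota> x) = x" if "x \<in> carrier K" for x
    unfolding \<iota>_def by (rule someI_ex) (use enum_surj[OF that] in blast)
  have "X = conv_mat (\<lambda>x. X $$ (o1, \<iota> x))"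
  proof (rule eq_matI)
    fix i j assume "i < dim_row (conv_mat (\<lambda>x. X $$ (o1, \<iota> x)))" "j < dim_col (conv_mat (\<lambda>x. X $$ (o1, \<iota> x)))"
    then have ij: "i < n" "j < n" by auto
    define x where "x = inv (b i) \<otimes> b j"
    have x: "x \<in> carrier K" using ij by (simp add: x_def)
    have bj: "b j = b i \<otimes> b (\<iota> x)" using \<iota>[OF x] ij by (simp add: x_def m_assoc[symmetric])
    have bi: "b i = b i \<otimes> b o1" using o1 ij by simp
    have "X $$ (o1, \<iota> x) = (left_mat (b i) * X) $$ (i, \<iota> x)"
      by (rule left_mat_mult_index[OF X _ ij(1) _ o1(1) bi, symmetric]) (use ij \<iota>[OF x] in auto)
    also have "\<dots> = (X * left_mat (b i)) $$ (i, \<iota> x)" using comm[of "b i"] ij by simp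
    also have "\<dots> = X $$ (i, j)"
      by (rule mult_left_mat_index[OF X _ ij(1) _ ij(2) bj]) (use ij \<iota>[OF x] in auto)
    finally show "X $$ (i, j) = conv_mat (\<lambda>x. X $$ (o1, \<iota> x)) $$ (i, j)" using ij by (simp add: x_def)
  qed (use X in auto)
  then show ?thesis by (rule that)
qed

text \<open>The functional calculus stays inside the commutant of the left translations, which is
  the algebra of convolution matrices.\<close>

lemma mat_fun_conv_mat:
  assumes "hermitian n (conv_mat f)"
  obtains f' where "mat_fun n g (conv_mat f) = conv_mat f'"
proof (rule left_invariant_conv_mat)
  show "mat_fun n g (conv_mat f) \<in> carrier_mat n n" using assms by simp
  show "left_mat w * mat_fun n g (conv_mat f) = mat_fun n g (conv_mat f) * left_mat w" if "w \<in> carrier K" for w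
    by (rule mat_fun_commute[OF assms left_mat_carrier left_mat_commute_conv_mat[OF that]])
qed (rule that)


section \<open>Averaging over conjugation\<close>

lemma sum_mat_reindex_translate:
  assumes "v \<in> carrier K"
  shows "sum_mat n (\<lambda>u. A (v \<otimes> u)) (carrier K) = sum_mat n A (carrier K)"
  by (intro eq_matI) (auto simp: sum_translate[OF assms, of "\<lambda>u. A u $$ _"])

text \<open>Left unnormalized: the missing factor 1 / |K| would cancel in the quotient of two
  averages that forms the central element.\<close>

definition average :: "complex mat \<Rightarrow> complex mat" where
  "average X = sum_mat n (\<lambda>u. trans_mat u * X * trans_mat (inv u)) (carrier K)"

lemma average_carrier [simp]: "average X \<in> carrier_mat n n"
  by (simp add: average_def)

lemma average_central:
  assumes X: "X \<in> carrier_mat n n" and v: "v \<in> carrier K"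
  shows "average X * trans_mat v = trans_mat v * average X"
proof -
  have c: "trans_mat u * X * trans_mat (inv u) \<in> carrier_mat n n" for u using X by simp
  have "trans_mat v * average X = sum_mat n (\<lambda>u. trans_mat v * (trans_mat u * X * trans_mat (inv u))) (carrier K)"
    unfolding average_def by (rule sum_mat_mult_left) (use X in auto)
  also have "\<dots> = sum_mat n (\<lambda>u. trans_mat (v \<otimes> u) * X * trans_mat (inv (v \<otimes> u)) * trans_mat v) (carrier K)"
  proof (rule sum_mat_cong)
    fix u assume u: "u \<in> carrier K"
    have "trans_mat (v \<otimes> u) * X * trans_mat (inv (v \<otimes> u)) * trans_mat v =
        (trans_mat v * trans_mat u) * X * (trans_mat (inv u) * (trans_mat (inv v) * trans_mat v))"
      using X u v by (simp add: inv_mult_group trans_mat_mult square_mat_mult_assoc[of _ n] m_assoc)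
    also have "\<dots> = trans_mat v * (trans_mat u * X * trans_mat (inv u))"
      using X u v by (simp add: trans_mat_inv square_mat_mult_assoc[of _ n])
    finally show "trans_mat v * (trans_mat u * X * trans_mat (inv u)) =
        trans_mat (v \<otimes> u) * X * trans_mat (inv (v \<otimes> u)) * trans_mat v" ..
  qed
  also have "\<dots> = sum_mat n (\<lambda>u. trans_mat u * X * trans_mat (inv u) * trans_mat v) (carrier K)"
    by (rule sum_mat_reindex_translate[OF v])
  also have "\<dots> = average X * trans_mat v"
    unfolding average_def by (rule sum_mat_mult_right[symmetric]) (use X in auto)
  finally show ?thesis ..
qed

lemma psd_average:
  assumes "psd n X"
  shows "psd n (average X)"
  unfolding average_def
proof (rule psd_sum_mat)
  fix u assume u: "u \<in> carrier K"
  show "psd n (trans_mat u * X * trans_mat (inv u))"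
    using psd_conj[OF assms trans_mat_carrier, of "inv u"] u by (simp add: mat_adjoint_trans_mat)
qed

lemma average_conv_mat:
  obtains f' where "average (conv_mat f) = conv_mat f'"
proof (rule left_invariant_conv_mat[OF average_carrier])
  fix w assume w: "w \<in> carrier K"
  have "trans_mat u * conv_mat f * trans_mat (inv u) = conv_mat (\<lambda>x. f (inv u \<otimes> (x \<otimes> inv (inv u))))"
    if "u \<in> carrier K" for u
    using that conv_mat_mult_trans_mat[of "inv u"] by (simp add: trans_mat_mult_conv_mat)
  then show "left_mat w * average (conv_mat f) = average (conv_mat f) * left_mat w"
    unfolding average_def using w
    by (simp add: sum_mat_mult_left[OF left_mat_carrier] sum_mat_mult_right[OF left_mat_carrier]
        left_mat_commute_conv_mat cong: sum_mat_cong)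
qed (rule that)

section \<open>The projection onto right-invariant vectors of a subgroup, and its Hecke
  algebra\<close>

definition subgroup_proj :: "'a set \<Rightarrow> complex mat" where
  "subgroup_proj L = conv_mat (\<lambda>x. if x \<in> L then 1 / of_nat (card L) else 0)"

lemma subgroup_proj_carrier [simp]: "subgroup_proj L \<in> carrier_mat n n"
  by (simp add: subgroup_proj_def)

context
  fixes L
  assumes L: "subgroup L K"
begin

lemma L_closed [simp]: "h \<in> L \<Longrightarrow> h \<in> carrier K"
  using L by (rule subgroup.mem_carrier)

lemma card_L: "card L > 0"
  using L finite_carrier by (metis card_gt_0_iff empty_iff finite_subset subgroup.one_closed subgroup.subset)

lemma trans_mat_mult_subgroup_proj:
  assumes h: "h \<in> L"
  shows "trans_mat h * subgroup_proj L = subgroup_proj L"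
proof -
  have "inv h \<otimes> x \<in> L \<longleftrightarrow> x \<in> L" if x: "x \<in> carrier K" for x
  proof
    assume "inv h \<otimes> x \<in> L"
    then have "h \<otimes> (inv h \<otimes> x) \<in> L" using h L by (simp add: subgroup.m_closed)
    then show "x \<in> L" using h x by (simp add: m_assoc[symmetric])
  qed (use h L in \<open>simp add: subgroup.m_closed subgroup.m_inv_closed\<close>)
  then show ?thesis unfolding subgroup_proj_def using h
    by (subst trans_mat_mult_conv_mat) (auto intro!: conv_mat_cong)
qed

lemma subgroup_proj_mult_trans_mat:
  assumes h: "h \<in> L"
  shows "subgroup_proj L * trans_mat h = subgroup_proj L"
proof -
  have "x \<otimes> inv h \<in> L \<longleftrightarrow> x \<in> L" if x: "x \<in> carrier K" for x
  proof
    assume "x \<otimes> inv h \<in> L"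
    then have "x \<otimes> inv h \<otimes> h \<in> L" using h L by (simp add: subgroup.m_closed)
    then show "x \<in> L" using h x by (simp add: m_assoc)
  qed (use h L in \<open>simp add: subgroup.m_closed subgroup.m_inv_closed\<close>)
  then show ?thesis unfolding subgroup_proj_def using h
    by (subst conv_mat_mult_trans_mat) (auto intro!: conv_mat_cong)
qed

lemma subgroup_proj_idem: "subgroup_proj L * subgroup_proj L = subgroup_proj L"
proof -
  define \<epsilon> :: "'a \<Rightarrow> complex" where "\<epsilon> x = (if x \<in> L then 1 / of_nat (card L) else 0)" for x
  have e: "subgroup_proj L = conv_mat \<epsilon>" unfolding subgroup_proj_def \<epsilon>_def ..
  have "convolution K \<epsilon> \<epsilon> x = \<epsilon> x" if x: "x \<in> carrier K" for x
  proof -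
    have inv: "\<epsilon> (inv h \<otimes> x) = \<epsilon> x" if h: "h \<in> L" for h
      using trans_mat_mult_subgroup_proj[OF h] conv_mat_inj[of "\<lambda>x. \<epsilon> (inv h \<otimes> x)" \<epsilon>, OF _ x] h
      unfolding e by (simp add: trans_mat_mult_conv_mat)
    have "convolution K \<epsilon> \<epsilon> x = (\<Sum>y\<in>carrier K. if y \<in> L then 1 / of_nat (card L) * \<epsilon> x else 0)"
      unfolding convolution_def by (intro sum.cong refl) (auto simp: \<epsilon>_def[of "_ :: 'a"] inv[unfolded \<epsilon>_def])
    also have "\<dots> = (\<Sum>y\<in>L. 1 / of_nat (card L) * \<epsilon> x)"
      using finite_carrier L by (intro sum.mono_neutral_cong_right) (auto dest: subgroup.subset)
    also have "\<dots> = \<epsilon> x" using card_L by simp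
    finally show ?thesis .
  qed
  then show ?thesis unfolding e conv_mat_mult by (rule conv_mat_cong)
qed

lemma subgroup_proj_adjoint: "mat_adjoint (subgroup_proj L) = subgroup_proj L"
proof -
  have "inv x \<in> L \<longleftrightarrow> x \<in> L" if "x \<in> carrier K" for x
    using L that by (metis inv_inv subgroup.m_inv_closed)
  then show ?thesis unfolding subgroup_proj_def mat_adjoint_conv_mat by (intro conv_mat_cong) auto
qed

lemma psd_subgroup_proj: "psd n (subgroup_proj L)"
  using psd_square[of n "subgroup_proj L"] subgroup_proj_idem subgroup_proj_adjoint by (simp add: hermitian_def)

text \<open>Being fixed by the projection on both sides is bi-invariance in matrix form: the
  projection absorbs each \<open>trans_mat h\<close> with h in \<open>L\<close>, and such a factor
  shifts the argument of the kernel by the inverse of h.\<close>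

lemma gelfand_commute:
  assumes gel: "gelfand_pair K L"
    and f: "subgroup_proj L * conv_mat f = conv_mat f" "conv_mat f * subgroup_proj L = conv_mat f"
    and g: "subgroup_proj L * conv_mat g = conv_mat g" "conv_mat g * subgroup_proj L = conv_mat g"
  shows "conv_mat f * conv_mat g = conv_mat g * conv_mat f"
proof -
  have bi: "bi_invariant K L f"
    if "subgroup_proj L * conv_mat f = conv_mat f" "conv_mat f * subgroup_proj L = conv_mat f" for f
    unfolding bi_invariant_def
  proof (intro ballI conjI)
    fix x h assume x: "x \<in> carrier K" and h: "h \<in> L"
    have h': "inv h \<in> L" using h L by (simp add: subgroup.m_inv_closed)
    have "trans_mat (inv h) * conv_mat f = (trans_mat (inv h) * subgroup_proj L) * conv_mat f"
      using that(1) by (simp add: square_mat_mult_assoc[of _ n])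
    then have "trans_mat (inv h) * conv_mat f = conv_mat f"
      using that(1) trans_mat_mult_subgroup_proj[OF h'] by simp
    then have "conv_mat (\<lambda>x. f (h \<otimes> x)) = conv_mat f" using h by (simp add: trans_mat_mult_conv_mat)
    from conv_mat_inj[OF this x] show "f (h \<otimes> x) = f x" .
    have "conv_mat f * trans_mat (inv h) = conv_mat f * (subgroup_proj L * trans_mat (inv h))"
      using that(2) by (simp add: square_mat_mult_assoc[of _ n, symmetric] del: assoc_mult_mat)
    then have "conv_mat f * trans_mat (inv h) = conv_mat f"
      using that(2) subgroup_proj_mult_trans_mat[OF h'] by simp
    then have "conv_mat (\<lambda>x. f (x \<otimes> h)) = conv_mat f" using h by (simp add: conv_mat_mult_trans_mat)
    from conv_mat_inj[OF this x] show "f (x \<otimes> h) = f x" .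
  qed
  show ?thesis unfolding conv_mat_mult
    by (rule conv_mat_cong) (use gel bi[OF f] bi[OF g] in \<open>auto simp: gelfand_pair_def\<close>)
qed

text \<open>For a Gel'fand pair the centre of the group algebra surjects onto the Hecke algebra, since
  \<open>e \<nu> e\<close> acts on each isotypic component as a scalar multiple of \<open>e\<close>. The central element is
  found without representation theory: commutativity gives
  \<open>(e \<nu> e) D = C\<^sub>0 e\<close> for the averages \<open>D\<close> of \<open>e\<close> and \<open>C\<^sub>0\<close> of \<open>e \<nu> e\<close>
  over conjugation, and \<open>D\<close> is invertible on the image of \<open>e\<close>.\<close>

lemma hecke_central_lift:
  assumes gel: "gelfand_pair K L" and N: "psd n (conv_mat \<nu>)"
  obtains C where "psd n C" "\<And>f. C * conv_mat f = conv_mat f * C"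
    "subgroup_proj L * conv_mat \<nu> * subgroup_proj L = C * subgroup_proj L"
proof -
  let ?e = "subgroup_proj L"
  define \<omega> where "\<omega> = ?e * conv_mat \<nu> * ?e"
  define D where "D = average ?e"
  define C0 where "C0 = average \<omega>"
  let ?I = "mat_fun n inverse D" and ?E = "mat_fun n (\<lambda>x. if x = 0 then 0 else 1) D"
  have \<omega>c: "\<omega> \<in> carrier_mat n n" by (simp add: \<omega>_def)
  have e\<omega>: "?e * \<omega> = \<omega>"
  proof -
    have "?e * \<omega> = (?e * ?e) * conv_mat \<nu> * ?e" unfolding \<omega>_def by (simp add: square_mat_mult_assoc[of _ n])
    then show ?thesis by (simp add: subgroup_proj_idem \<omega>_def)
  qed
  have \<omega>e: "\<omega> * ?e = \<omega>"
    unfolding \<omega>_def by (simp add: square_mat_mult_assoc[of _ n] subgroup_proj_idem)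
  have \<omega>p: "psd n \<omega>" using psd_conj[OF N, of ?e] by (simp add: \<omega>_def subgroup_proj_adjoint)
  have \<omega>f: "\<exists>f. \<omega> = conv_mat f" unfolding \<omega>_def subgroup_proj_def conv_mat_mult by blast
  have Dp: "psd n D" and C0p: "psd n C0" unfolding D_def C0_def by (intro psd_average psd_subgroup_proj \<omega>p)+
  have hD: "hermitian n D" using Dp by (rule psd_hermitian)
  have c: "D \<in> carrier_mat n n" "C0 \<in> carrier_mat n n" "?I \<in> carrier_mat n n" "?E \<in> carrier_mat n n"
    using hD by (auto simp: D_def C0_def)
  have Dz: "D * conv_mat f = conv_mat f * D" for f
    by (rule commute_conv_mat[OF c(1)]) (simp add: D_def average_central)
  have C0z: "C0 * conv_mat f = conv_mat f * C0" for f
    by (rule commute_conv_mat[OF c(2)]) (simp add: C0_def average_central \<omega>c)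
  have Iz: "?I * conv_mat f = conv_mat f * ?I" for f
    by (rule mat_fun_commute[OF hD conv_mat_carrier, symmetric]) (simp add: Dz)
  have ez: "D * ?e = ?e * D" "C0 * ?e = ?e * C0" "?I * ?e = ?e * ?I"
    unfolding subgroup_proj_def by (rule Dz C0z Iz)+
  obtain d where d: "D = conv_mat d" unfolding D_def subgroup_proj_def using average_conv_mat by blast
  have C0I: "C0 * ?I = ?I * C0"
    by (rule mat_fun_commute[OF hD c(2)]) (simp add: d C0z)
  \<comment> \<open>Both factors are convolution matrices fixed by \<open>?e\<close> on the left and
    on the right, so the Gel'fand hypothesis applies. This is the only place where it enters the
    argument.\<close>
  have hecke: "\<omega> * (?e * trans_mat u * ?e) = (?e * trans_mat u * ?e) * \<omega>" for u
  proof -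
    obtain f where f: "\<omega> = conv_mat f" using \<omega>f by blast
    obtain g where g: "?e * trans_mat u * ?e = conv_mat g"
      unfolding subgroup_proj_def trans_mat_def conv_mat_mult by blast
    have "?e * (?e * trans_mat u * ?e) = (?e * ?e) * trans_mat u * ?e" by (simp add: square_mat_mult_assoc[of _ n])
    then have eg: "?e * conv_mat g = conv_mat g" "conv_mat g * ?e = conv_mat g"
      unfolding g[symmetric] by (simp_all add: subgroup_proj_idem square_mat_mult_assoc[of _ n])
    show ?thesis unfolding g using e\<omega> \<omega>e unfolding f by (intro gelfand_commute[OF gel _ _ eg])
  qed
  have "\<omega> * D = \<omega> * (D * ?e)"
  proof -
    have "\<omega> * (D * ?e) = (\<omega> * ?e) * D" using c \<omega>c by (simp add: ez square_mat_mult_assoc[of _ n])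
    then show ?thesis by (simp add: \<omega>e)
  qed
  also have "\<dots> = sum_mat n (\<lambda>u. \<omega> * (trans_mat u * ?e * trans_mat (inv u) * ?e)) (carrier K)"
    unfolding D_def average_def by (simp add: sum_mat_mult_right sum_mat_mult_left \<omega>c)
  \<comment> \<open>Writing \<open>\<omega>\<close> as \<open>\<omega> * ?e\<close> completes the
    Hecke element \<open>?e * trans_mat u * ?e\<close>. Commuting \<open>\<omega>\<close> past it
    puts \<open>\<omega>\<close> inside the conjugation by u, so the average of \<open>?e\<close>
    turns into the average of \<open>\<omega>\<close>.\<close>
  also have "\<dots> = sum_mat n (\<lambda>u. ?e * (trans_mat u * \<omega> * trans_mat (inv u) * ?e)) (carrier K)"
  proof (rule sum_mat_cong)
    fix u assume "u \<in> carrier K"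
    have "\<omega> * (trans_mat u * ?e * trans_mat (inv u) * ?e) = (\<omega> * ?e) * trans_mat u * ?e * trans_mat (inv u) * ?e"
      unfolding \<omega>e using \<omega>c by (simp add: square_mat_mult_assoc[of _ n])
    also have "\<dots> = \<omega> * (?e * trans_mat u * ?e) * (trans_mat (inv u) * ?e)"
      using \<omega>c by (simp add: square_mat_mult_assoc[of _ n])
    also have "\<dots> = ?e * trans_mat u * (?e * \<omega>) * trans_mat (inv u) * ?e"
      unfolding hecke using \<omega>c by (simp add: square_mat_mult_assoc[of _ n])
    also have "\<dots> = ?e * (trans_mat u * \<omega> * trans_mat (inv u) * ?e)"
      unfolding e\<omega> using \<omega>c by (simp add: square_mat_mult_assoc[of _ n])
    finally show "\<omega> * (trans_mat u * ?e * trans_mat (inv u) * ?e) = ?e * (trans_mat u * \<omega> * trans_mat (inv u) * ?e)" .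
  qed
  also have "\<dots> = ?e * (C0 * ?e)"
    unfolding C0_def average_def by (simp add: sum_mat_mult_right sum_mat_mult_left \<omega>c)
  also have "\<dots> = C0 * ?e"
  proof -
    have "?e * (C0 * ?e) = C0 * (?e * ?e)" 
      using c by (simp add: square_mat_left_commute[OF ez(2), of n])
    then show ?thesis by (simp add: subgroup_proj_idem)
  qed
  finally have \<omega>D: "\<omega> * D = C0 * ?e" .
  \<comment> \<open>This is the invertibility of \<open>D\<close> on the image of \<open>?e\<close>:
    the unit contributes \<open>?e\<close> itself to the positive sum \<open>D\<close>, so
    \<open>?e\<close> is supported where \<open>D\<close> is.\<close>
  have eE: "?e * ?E = ?e"
  proof -
    have "trans_mat \<one> * ?e * trans_mat (inv \<one>) = ?e" by (simp add: trans_mat_one)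
    moreover have "(trans_mat \<one> * ?e * trans_mat (inv \<one>)) * ?E = trans_mat \<one> * ?e * trans_mat (inv \<one>)"
      unfolding D_def average_def
    proof (rule psd_summand_mult_support[where A = "\<lambda>u. trans_mat u * ?e * trans_mat (inv u)"])
      show "psd n (trans_mat u * ?e * trans_mat (inv u))" if "u \<in> carrier K" for u
        using psd_conj[OF psd_subgroup_proj trans_mat_carrier, of "inv u"] that by (simp add: mat_adjoint_trans_mat)
    qed (auto simp: finite_carrier)
    ultimately show ?thesis by simp
  qed
  have DI: "D * ?I = ?E" by (rule mat_fun_mult_self_psd[OF Dp]) simp
  \<comment> \<open>Division of \<open>\<omega> * D = C0 * ?e\<close> by \<open>D\<close>, with the
    pseudo-inverse \<open>?I\<close> in place of an inverse.\<close>
  have "\<omega> = \<omega> * (?e * ?E)" by (simp add: eE \<omega>e)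
  also have "\<dots> = \<omega> * D * ?I"
    using c \<omega>c \<omega>e DI by (simp add: square_mat_mult_assoc[of _ n, symmetric] del: assoc_mult_mat) 
      (simp add: square_mat_mult_assoc[of _ n])
  also have "\<dots> = C0 * ?I * ?e"
    unfolding \<omega>D using c ez(3) by (simp add: square_mat_mult_assoc[of _ n])
  finally have main: "\<omega> = C0 * ?I * ?e" .
  show ?thesis
  proof (rule that)
    have "psd n ?I"
    proof -
      \<comment> \<open>\<open>inverse\<close> is negative at negative reals, so positivity is read
        off a function that agrees with it on the spectrum of \<open>D\<close>.\<close>
      have "?I = mat_fun n (\<lambda>x. \<bar>inverse x\<bar>) D" by (rule mat_fun_cong_psd[OF Dp]) simp
      then show ?thesis using mat_fun_psd[OF hD, of "\<lambda>x. \<bar>inverse x\<bar>"] by simp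
    qed
    then show "psd n (C0 * ?I)" by (rule psd_mult_commute[OF C0p _ C0I])
    show "C0 * ?I * conv_mat f = conv_mat f * (C0 * ?I)" for f
      using c by (simp add: square_mat_mult_assoc[of _ n] Iz square_mat_left_commute[OF C0z, of n])
    show "?e * conv_mat \<nu> * ?e = C0 * ?I * ?e" using main unfolding \<omega>_def .
  qed
qed

end

end

section \<open>Powers of Gel'fand pairs\<close>

text \<open>A positive multiple of the indicator of the double coset L a L for a finite subgroup
  \<open>L\<close>. As a double sum it is bi-invariant by a change of summation variable, and in a
  power of a group it factors over the coordinates.\<close>

definition double_coset_count :: "('a, 'm) monoid_scheme \<Rightarrow> 'a set \<Rightarrow> 'a \<Rightarrow> 'a \<Rightarrow> complex" where
  "double_coset_count K L a x =
     (\<Sum>h\<in>L. \<Sum>h'\<in>L. if h \<otimes>\<^bsub>K\<^esub> a \<otimes>\<^bsub>K\<^esub> h' = x then 1 else 0)"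

context group
begin

lemma sum_subgroup_translate:
  assumes "subgroup L G" "u \<in> L"
  shows "(\<Sum>h\<in>L. g (u \<otimes> h)) = (\<Sum>h\<in>L. g h)" "(\<Sum>h\<in>L. g (h \<otimes> u)) = (\<Sum>h\<in>L. g h)"
proof -
  have [simp]: "h \<in> carrier G" if "h \<in> L" for h using assms(1) that by (rule subgroup.mem_carrier)
  show "(\<Sum>h\<in>L. g (u \<otimes> h)) = (\<Sum>h\<in>L. g h)"
    by (rule sum.reindex_bij_witness[of _ "\<lambda>y. inv u \<otimes> y" "\<lambda>y. u \<otimes> y"])
      (use assms in \<open>auto simp: m_assoc[symmetric] subgroup.m_closed subgroup.m_inv_closed\<close>)
  show "(\<Sum>h\<in>L. g (h \<otimes> u)) = (\<Sum>h\<in>L. g h)"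
    by (rule sum.reindex_bij_witness[of _ "\<lambda>y. y \<otimes> inv u" "\<lambda>y. y \<otimes> u"])
      (use assms in \<open>auto simp: m_assoc subgroup.m_closed subgroup.m_inv_closed\<close>)
qed

lemma mult_inv_cancel:
  assumes "u \<in> carrier G" "z \<in> carrier G"
  shows "u \<otimes> (inv u \<otimes> z) = z" "inv u \<otimes> (u \<otimes> z) = z"
  using assms by (simp_all add: m_assoc[symmetric])

lemma bi_invariant_double_coset_count:
  assumes L: "subgroup L G" and a: "a \<in> carrier G"
  shows "bi_invariant G L (double_coset_count G L a)"
  unfolding bi_invariant_def
proof (intro ballI conjI)
  fix x u assume x: "x \<in> carrier G" and u: "u \<in> L"
  have [simp]: "h \<in> carrier G" if "h \<in> L" for h using L that by (rule subgroup.mem_carrier)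
  have "double_coset_count G L a (u \<otimes> x) =
      (\<Sum>h\<in>L. \<Sum>h'\<in>L. if u \<otimes> h \<otimes> a \<otimes> h' = u \<otimes> x then 1 else 0)"
    unfolding double_coset_count_def
    using sum_subgroup_translate(1)[OF L u, of "\<lambda>h. \<Sum>h'\<in>L. if h \<otimes> a \<otimes> h' = u \<otimes> x then 1 else (0::complex)"] by simp
  also have "\<dots> = double_coset_count G L a x"
    unfolding double_coset_count_def using x u a by (intro sum.cong refl) (simp add: m_assoc)
  finally show "double_coset_count G L a (u \<otimes> x) = double_coset_count G L a x" .
  have "double_coset_count G L a (x \<otimes> u) =
      (\<Sum>h\<in>L. \<Sum>h'\<in>L. if h \<otimes> a \<otimes> (h' \<otimes> u) = x \<otimes> u then 1 else 0)"
    unfolding double_coset_count_def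
    using sum_subgroup_translate(2)[OF L u, of "\<lambda>h'. if _ \<otimes> a \<otimes> h' = x \<otimes> u then 1 else (0::complex)"] by simp
  also have "\<dots> = double_coset_count G L a x"
    unfolding double_coset_count_def using x u a by (intro sum.cong refl) (simp add: m_assoc[symmetric])
  finally show "double_coset_count G L a (x \<otimes> u) = double_coset_count G L a x" .
qed

text \<open>For each pair h, h' exactly one \<open>a\<close> satisfies h a h' = x, and there f a = f
  x. The |L|^2 pairs contribute equally, so the counting functions span the bi-invariant
  functions.\<close>

lemma bi_invariant_expansion:
  assumes fin: "finite (carrier G)" and L: "subgroup L G" and f: "bi_invariant G L f" and x: "x \<in> carrier G"
  shows "(\<Sum>a\<in>carrier G. f a * double_coset_count G L a x) = of_nat (card L) ^ 2 * f x"
proof -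
  have [simp]: "h \<in> carrier G" if "h \<in> L" for h using L that by (rule subgroup.mem_carrier)
  have "(\<Sum>a\<in>carrier G. f a * double_coset_count G L a x) =
      (\<Sum>a\<in>carrier G. \<Sum>h\<in>L. \<Sum>h'\<in>L. f a * (if h \<otimes> a \<otimes> h' = x then 1 else 0))"
    unfolding double_coset_count_def by (simp add: sum_distrib_left)
  also have "\<dots> = (\<Sum>h\<in>L. \<Sum>a\<in>carrier G. \<Sum>h'\<in>L. f a * (if h \<otimes> a \<otimes> h' = x then 1 else 0))"
    by (rule sum.swap)
  also have "\<dots> = (\<Sum>h\<in>L. \<Sum>h'\<in>L. \<Sum>a\<in>carrier G. f a * (if h \<otimes> a \<otimes> h' = x then 1 else 0))"
    by (rule sum.cong[OF refl]) (rule sum.swap)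
  also have "\<dots> = (\<Sum>h\<in>L. \<Sum>h'\<in>L. f x)"
  proof (intro sum.cong refl)
    fix h h' assume h: "h \<in> L" "h' \<in> L"
    define y where "y = inv h \<otimes> x \<otimes> inv h'"
    have y: "y \<in> carrier G" using x h by (simp add: y_def)
    have "f x = f (h \<otimes> (y \<otimes> h'))" using x h by (simp add: y_def m_assoc) (simp add: m_assoc[symmetric])
    then have fy: "f y = f x" using f h y unfolding bi_invariant_def by simp
    have "h \<otimes> a \<otimes> h' = x \<longleftrightarrow> a = y" if a: "a \<in> carrier G" for a
      using a x h unfolding y_def by (metis \<open>\<And>h. h \<in> L \<Longrightarrow> h \<in> carrier G\<close> inv_closed inv_solve_left inv_solve_right m_assoc m_closed)
    then have "(\<Sum>a\<in>carrier G. f a * (if h \<otimes> a \<otimes> h' = x then 1 else 0)) = (\<Sum>a\<in>carrier G. if a = y then f y else 0)"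
      by (intro sum.cong refl) auto
    then show "(\<Sum>a\<in>carrier G. f a * (if h \<otimes> a \<otimes> h' = x then 1 else 0)) = f x"
      using fin y fy by simp
  qed
  also have "\<dots> = of_nat (card L) ^ 2 * f x" by (simp add: power2_eq_square)
  finally show ?thesis .
qed

text \<open>Convolution is bilinear, so its symmetry may be checked on the spanning family of
  counting functions. Expanding both arguments costs the nonzero factor |L|^4, cancelled at the
  end.\<close>

lemma gelfand_pairI:
  assumes fin: "finite (carrier G)" and L: "subgroup L G"
    and sym: "\<And>a c x. a \<in> carrier G \<Longrightarrow> c \<in> carrier G \<Longrightarrow> x \<in> carrier G \<Longrightarrow>
      convolution G (double_coset_count G L a) (double_coset_count G L c) x =
      convolution G (double_coset_count G L c) (double_coset_count G L a) x"
  shows "gelfand_pair G L"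
  unfolding gelfand_pair_def
proof (intro allI impI ballI)
  fix f g x assume f: "bi_invariant G L f" and g: "bi_invariant G L g" and x: "x \<in> carrier G"
  let ?d = "double_coset_count G L" and ?l = "of_nat (card L) ^ 2 :: complex"
  have l0: "?l \<noteq> 0"
    using L fin by (metis card_0_eq empty_iff finite_subset of_nat_eq_0_iff power_not_zero subgroup.one_closed subgroup.subset)
  have ex: "?l * ?l * convolution G f g x =
      (\<Sum>a\<in>carrier G. \<Sum>c\<in>carrier G. f a * g c * convolution G (?d a) (?d c) x)"
    if f: "bi_invariant G L f" and g: "bi_invariant G L g" for f g
  proof -
    have "?l * ?l * convolution G f g x = (\<Sum>y\<in>carrier G. (?l * f y) * (?l * g (inv y \<otimes> x)))"
      unfolding convolution_def by (simp add: sum_distrib_left mult_ac)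
    also have "\<dots> = (\<Sum>y\<in>carrier G. (\<Sum>a\<in>carrier G. f a * ?d a y) * (\<Sum>c\<in>carrier G. g c * ?d c (inv y \<otimes> x)))"
      using x by (intro sum.cong refl) (simp add: bi_invariant_expansion[OF fin L f] bi_invariant_expansion[OF fin L g])
    also have "\<dots> = (\<Sum>y\<in>carrier G. \<Sum>a\<in>carrier G. \<Sum>c\<in>carrier G. f a * g c * (?d a y * ?d c (inv y \<otimes> x)))"
      by (simp add: sum_product mult_ac)
    also have "\<dots> = (\<Sum>a\<in>carrier G. \<Sum>y\<in>carrier G. \<Sum>c\<in>carrier G. f a * g c * (?d a y * ?d c (inv y \<otimes> x)))"
      by (rule sum.swap)
    also have "\<dots> = (\<Sum>a\<in>carrier G. \<Sum>c\<in>carrier G. \<Sum>y\<in>carrier G. f a * g c * (?d a y * ?d c (inv y \<otimes> x)))"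
      by (rule sum.cong[OF refl]) (rule sum.swap)
    also have "\<dots> = (\<Sum>a\<in>carrier G. \<Sum>c\<in>carrier G. f a * g c * convolution G (?d a) (?d c) x)"
      unfolding convolution_def by (simp add: sum_distrib_left)
    finally show ?thesis .
  qed
  have "?l * ?l * convolution G f g x = (\<Sum>a\<in>carrier G. \<Sum>c\<in>carrier G. f a * g c * convolution G (?d c) (?d a) x)"
    unfolding ex[OF f g] using x by (intro sum.cong refl) (simp add: sym)
  also have "\<dots> = (\<Sum>c\<in>carrier G. \<Sum>a\<in>carrier G. f a * g c * convolution G (?d c) (?d a) x)"
    by (rule sum.swap)
  also have "\<dots> = ?l * ?l * convolution G g f x"
    unfolding ex[OF g f] by (simp add: mult_ac)
  finally show "convolution G f g x = convolution G g f x" using l0 by simp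
qed

end

text \<open>A counting function on the power is a product of counting functions on the factors, and
  so is a convolution of two of them. Symmetry therefore holds coordinate by coordinate, and the
  spanning property extends it to bi-invariant functions that are not products.\<close>

lemma gelfand_pair_product_group:
  fixes G (structure)
  assumes G: "group G" and fin: "finite (carrier G)" and H: "subgroup H G" and gel: "gelfand_pair G H"
    and I: "finite I"
  shows "gelfand_pair (product_group I (\<lambda>_. G)) (I \<rightarrow>\<^sub>E H)"
proof -
  let ?K = "product_group I (\<lambda>_. G)" and ?L = "I \<rightarrow>\<^sub>E H"
  interpret group G by (rule G)
  interpret K: group ?K by (rule product_group) (rule G)
  have finH: "finite H" using H fin by (metis finite_subset subgroup.subset)
  have HG: "h \<in> carrier G" if "h \<in> H" for h using H that by (rule subgroup.mem_carrier)
  have d: "double_coset_count ?K ?L a x = (\<Prod>i\<in>I. double_coset_count G H (a i) (x i))"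
    if a: "a \<in> carrier ?K" and x: "x \<in> carrier ?K" for a x
  proof -
    have ind: "(if h \<otimes>\<^bsub>?K\<^esub> a \<otimes>\<^bsub>?K\<^esub> h' = x then 1 else 0) =
        (\<Prod>i\<in>I. if h i \<otimes> a i \<otimes> h' i = x i then 1 else (0::complex))" for h h'
    proof -
      \<comment> \<open>Elements of the product group are extensional, so equality is decided on
        \<open>I\<close> and the indicator is a product of coordinate indicators.\<close>
      have "h \<otimes>\<^bsub>?K\<^esub> a \<otimes>\<^bsub>?K\<^esub> h' = x \<longleftrightarrow> (\<forall>i\<in>I. h i \<otimes> a i \<otimes> h' i = x i)"
        using x by (auto simp: fun_eq_iff PiE_def extensional_def restrict_def)
      then show ?thesis using I by (auto intro!: prod.neutral[symmetric] prod_zero[symmetric])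
    qed
    have "(\<Prod>i\<in>I. double_coset_count G H (a i) (x i)) =
        (\<Sum>h\<in>?L. \<Prod>i\<in>I. \<Sum>h'\<in>H. if h i \<otimes> a i \<otimes> h' = x i then 1 else (0::complex))"
      unfolding double_coset_count_def using I finH by (subst prod_sum_PiE) auto
    also have "\<dots> = (\<Sum>h\<in>?L. \<Sum>h'\<in>?L. \<Prod>i\<in>I. if h i \<otimes> a i \<otimes> h' i = x i then 1 else (0::complex))"
      using I finH by (intro sum.cong refl, subst prod_sum_PiE) auto
    finally show ?thesis unfolding double_coset_count_def ind ..
  qed
  have conv: "convolution ?K (double_coset_count ?K ?L a) (double_coset_count ?K ?L c) x =
      (\<Prod>i\<in>I. convolution G (double_coset_count G H (a i)) (double_coset_count G H (c i)) (x i))"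
    if a: "a \<in> carrier ?K" and c: "c \<in> carrier ?K" and x: "x \<in> carrier ?K" for a c x
  proof -
    have "convolution ?K (double_coset_count ?K ?L a) (double_coset_count ?K ?L c) x =
        (\<Sum>y\<in>I \<rightarrow>\<^sub>E carrier G. \<Prod>i\<in>I. double_coset_count G H (a i) (y i) * double_coset_count G H (c i) (inv (y i) \<otimes> x i))"
      unfolding convolution_def
    proof (rule sum.cong)
      fix y assume y: "y \<in> I \<rightarrow>\<^sub>E carrier G"
      then have yK: "y \<in> carrier ?K" by simp
      have "inv\<^bsub>?K\<^esub> y \<otimes>\<^bsub>?K\<^esub> x \<in> carrier ?K" using yK x by (rule K.m_closed[OF K.inv_closed])
      then have "double_coset_count ?K ?L c (inv\<^bsub>?K\<^esub> y \<otimes>\<^bsub>?K\<^esub> x) =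
          (\<Prod>i\<in>I. double_coset_count G H (c i) ((inv\<^bsub>?K\<^esub> y \<otimes>\<^bsub>?K\<^esub> x) i))" by (rule d[OF c])
      also have "\<dots> = (\<Prod>i\<in>I. double_coset_count G H (c i) (inv (y i) \<otimes> x i))"
        using yK G by (intro prod.cong refl) (simp add: inv_product_group)
      finally show "double_coset_count ?K ?L a y * double_coset_count ?K ?L c (inv\<^bsub>?K\<^esub> y \<otimes>\<^bsub>?K\<^esub> x) =
          (\<Prod>i\<in>I. double_coset_count G H (a i) (y i) * double_coset_count G H (c i) (inv (y i) \<otimes> x i))"
        using d[OF a yK] by (simp add: prod.distrib)
    qed simp
    also have "\<dots> = (\<Prod>i\<in>I. convolution G (double_coset_count G H (a i)) (double_coset_count G H (c i)) (x i))"
      unfolding convolution_def using I fin by (subst prod_sum_PiE) auto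
    finally show ?thesis .
  qed
  show ?thesis
  proof (rule K.gelfand_pairI)
    show "finite (carrier ?K)" using I fin by (simp add: finite_PiE)
    show "subgroup ?L ?K" using H G by (simp add: PiE_subgroup_product_group)
    fix a c x assume acx: "a \<in> carrier ?K" "c \<in> carrier ?K" "x \<in> carrier ?K"
    have "convolution G (double_coset_count G H (a i)) (double_coset_count G H (c i)) (x i) =
        convolution G (double_coset_count G H (c i)) (double_coset_count G H (a i)) (x i)" if "i \<in> I" for i
    proof -
      have "a i \<in> carrier G" "c i \<in> carrier G" "x i \<in> carrier G" using acx that by auto
      then show ?thesis using gel bi_invariant_double_coset_count[OF H] unfolding gelfand_pair_def by blast
    qed
    then show "convolution ?K (double_coset_count ?K ?L a) (double_coset_count ?K ?L c) x =
        convolution ?K (double_coset_count ?K ?L c) (double_coset_count ?K ?L a) x"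
      unfolding conv[OF acx] conv[OF acx(2,1,3)] by (rule prod.cong[OF refl])
  qed
qed

section \<open>Coset states\<close>

lemma psd_smult:
  assumes "psd n A" "0 \<le> r"
  shows "psd n (complex_of_real r \<cdot>\<^sub>m A)"
  unfolding psd_def
proof (intro conjI ballI)
  have A: "A \<in> carrier_mat n n" using assms(1) by (rule psd_carrier)
  then show "complex_of_real r \<cdot>\<^sub>m A \<in> carrier_mat n n" by simp
  fix v :: "complex vec" assume v: "v \<in> carrier_vec n"
  have "(complex_of_real r \<cdot>\<^sub>m A *\<^sub>v v) \<bullet>c v = complex_of_real r * ((A *\<^sub>v v) \<bullet>c v)"
    using A v by (simp add: scalar_prod_def sum_distrib_left mult_ac)
  moreover have "0 \<le> (A *\<^sub>v v) \<bullet>c v" using assms(1) v by (simp add: psd_def)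
  ultimately show "0 \<le> (complex_of_real r \<cdot>\<^sub>m A *\<^sub>v v) \<bullet>c v"
    using assms(2) by (simp add: less_eq_complex_def)
qed

context enumerated_group
begin

text \<open>Stated for conjugates of one subgroup under the image of an arbitrary homomorphism into
  \<open>K\<close>; the family of coset states on several registers is the case of the diagonal
  embedding.\<close>

theorem pretty_good_optimal_conjugates:
  fixes G :: "('g, 'm) monoid_scheme" and \<gamma> :: "'g \<Rightarrow> 'a" and \<alpha> :: real
  assumes L: "subgroup L K" and gel: "gelfand_pair K L"
    and G: "group G" and finG: "finite (carrier G)" and \<gamma>: "\<gamma> \<in> hom G K" and \<alpha>: "0 \<le> \<alpha>"
    and A: "\<And>g. A g = complex_of_real \<alpha> \<cdot>\<^sub>m (trans_mat (inv (\<gamma> g)) * subgroup_proj L * trans_mat (\<gamma> g))"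
    and N: "N = inv_sqrt_mat n (sum_mat n A (carrier G))"
    and F: "measurement n (carrier G) F"
  shows "(\<Sum>g\<in>carrier G. Re (trace_mat (F g * A g))) \<le> (\<Sum>g\<in>carrier G. Re (trace_mat (N * A g * N * A g)))"
proof -
  interpret G: group G by (rule G)
  let ?e = "subgroup_proj L" and ?\<alpha> = "complex_of_real \<alpha>"
  define M where "M = sum_mat n A (carrier G)"
  have \<gamma>c [simp]: "\<gamma> g \<in> carrier K" if "g \<in> carrier G" for g using \<gamma> that by (rule hom_in_carrier)
  have \<gamma>m: "\<gamma> (g \<otimes>\<^bsub>G\<^esub> g') = \<gamma> g \<otimes> \<gamma> g'" if "g \<in> carrier G" "g' \<in> carrier G" for g g'
    using \<gamma> that by (rule hom_mult)
  have cA: "A g \<in> carrier_mat n n" for g by (simp add: A)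
  have Ap: "psd n (A g)" if "g \<in> carrier G" for g
    unfolding A using psd_smult[OF psd_conj[OF psd_subgroup_proj[OF L] trans_mat_carrier, of "\<gamma> g"] \<alpha>] that
    by (simp add: mat_adjoint_trans_mat)
  have Mp: "psd n M" unfolding M_def by (rule psd_sum_mat[OF Ap])
  have hM: "hermitian n M" using Mp by (rule psd_hermitian)
  have cM: "M \<in> carrier_mat n n" by (simp add: M_def)
  have Af: "\<exists>f. A g = conv_mat f" for g
  proof -
    obtain f where "trans_mat (inv (\<gamma> g)) * ?e * trans_mat (\<gamma> g) = conv_mat f"
      unfolding subgroup_proj_def trans_mat_def conv_mat_mult by blast
    then have "A g = conv_mat (\<lambda>x. ?\<alpha> * f x)" unfolding A by (intro eq_matI) auto
    then show ?thesis by blast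
  qed
  obtain \<mu> where \<mu>: "M = conv_mat \<mu>"
  proof (rule left_invariant_conv_mat[OF cM])
    fix w assume w: "w \<in> carrier K"
    have "left_mat w * A g = A g * left_mat w" for g
      using Af[of g] left_mat_commute_conv_mat[OF w] by auto
    then show "left_mat w * M = M * left_mat w"
      unfolding M_def by (simp add: sum_mat_mult_left[OF left_mat_carrier cA] sum_mat_mult_right[OF left_mat_carrier cA])
  qed
  have Nf: "N = mat_fun n (\<lambda>x. inverse (sqrt \<bar>x\<bar>)) M"
    unfolding N M_def[symmetric] by (rule inv_sqrt_mat_eq[OF Mp])
  obtain \<nu> where \<nu>: "N = conv_mat \<nu>" using mat_fun_conv_mat hM unfolding Nf \<mu> by metis
  have Np: "psd n N" unfolding Nf by (rule mat_fun_psd[OF hM]) simp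
  have cN: "N \<in> carrier_mat n n" by (simp add: \<nu>)
  obtain C where C: "psd n C" and Cz: "\<And>f. C * conv_mat f = conv_mat f * C"
    and Ce: "?e * conv_mat \<nu> * ?e = C * ?e"
    using hecke_central_lift[OF L gel Np[unfolded \<nu>]] by blast
  have cC: "C \<in> carrier_mat n n" using C by (rule psd_carrier)
  \<comment> \<open>\<open>A (g' g)\<close> is \<open>A g'\<close> conjugated by the translation of
    g. Conjugation thus permutes the family, which makes \<open>M\<close>, and with it
    \<open>N\<close>, commute with these translations.\<close>
  have RA: "trans_mat (\<gamma> g) * A (g' \<otimes>\<^bsub>G\<^esub> g) = A g' * trans_mat (\<gamma> g)"
    if g: "g \<in> carrier G" "g' \<in> carrier G" for g g'
  proof -
    have "trans_mat (\<gamma> g) * (trans_mat (inv (\<gamma> (g' \<otimes>\<^bsub>G\<^esub> g))) * ?e * trans_mat (\<gamma> (g' \<otimes>\<^bsub>G\<^esub> g))) =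
      (trans_mat (\<gamma> g) * trans_mat (inv (\<gamma> g))) * (trans_mat (inv (\<gamma> g')) * ?e * trans_mat (\<gamma> g')) * trans_mat (\<gamma> g)"
      using g by (simp add: \<gamma>m inv_mult_group trans_mat_mult[symmetric] square_mat_mult_assoc[of _ n])
    then show ?thesis unfolding A using g
      by (simp add: trans_mat_inv mult_smult_distrib[of _ n n _ n] mult_smult_assoc_mat[of _ n n _ n])
  qed
  have RM: "trans_mat (\<gamma> g) * M = M * trans_mat (\<gamma> g)" if g: "g \<in> carrier G" for g
  proof -
    have "trans_mat (\<gamma> g) * M = sum_mat n (\<lambda>g'. trans_mat (\<gamma> g) * A g') (carrier G)"
      unfolding M_def by (rule sum_mat_mult_left[OF _ cA]) simp
    also have "\<dots> = sum_mat n (\<lambda>g'. trans_mat (\<gamma> g) * A (g' \<otimes>\<^bsub>G\<^esub> g)) (carrier G)"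
    proof (rule eq_matI)
      fix i j assume "i < dim_row (sum_mat n (\<lambda>g'. trans_mat (\<gamma> g) * A (g' \<otimes>\<^bsub>G\<^esub> g)) (carrier G))"
        "j < dim_col (sum_mat n (\<lambda>g'. trans_mat (\<gamma> g) * A (g' \<otimes>\<^bsub>G\<^esub> g)) (carrier G))"
      then show "sum_mat n (\<lambda>g'. trans_mat (\<gamma> g) * A g') (carrier G) $$ (i, j) =
          sum_mat n (\<lambda>g'. trans_mat (\<gamma> g) * A (g' \<otimes>\<^bsub>G\<^esub> g)) (carrier G) $$ (i, j)"
        using G.sum_subgroup_translate(2)[OF G.subgroup_self g, of "\<lambda>g'. (trans_mat (\<gamma> g) * A g') $$ (i, j)"] by simp
    qed auto
    also have "\<dots> = sum_mat n (\<lambda>g'. A g' * trans_mat (\<gamma> g)) (carrier G)"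
      by (rule sum_mat_cong) (simp add: RA g)
    also have "\<dots> = M * trans_mat (\<gamma> g)"
      unfolding M_def by (rule sum_mat_mult_right[OF _ cA, symmetric]) simp
    finally show ?thesis .
  qed
  have RN: "trans_mat (\<gamma> g) * N = N * trans_mat (\<gamma> g)" if g: "g \<in> carrier G" for g
    unfolding Nf by (rule mat_fun_commute[OF hM trans_mat_carrier RM[OF g]])
  show ?thesis
  proof (rule pretty_good_optimal[OF Ap refl _ finG, where C = "?\<alpha> \<cdot>\<^sub>m C"])
    \<comment> \<open>The product \<open>A g * N * A g\<close> carries the square of
      \<open>\<alpha>\<close>: one factor belongs to \<open>A g\<close>, the other goes into the
      certificate.\<close>
    show "psd n (?\<alpha> \<cdot>\<^sub>m C)" by (rule psd_smult[OF C \<alpha>])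
    fix g assume g: "g \<in> carrier G"
    obtain f where f: "A g = conv_mat f" using Af by blast
    show "?\<alpha> \<cdot>\<^sub>m C * A g = A g * (?\<alpha> \<cdot>\<^sub>m C)"
      unfolding f using cC by (simp add: Cz mult_smult_distrib[of _ n n _ n] mult_smult_assoc_mat[of _ n n _ n])
    let ?R = "trans_mat (\<gamma> g)" and ?S = "trans_mat (inv (\<gamma> g))"
    \<comment> \<open>\<open>N\<close> commutes with \<open>?R\<close>, so the inner translations
      cancel and only \<open>?e * N * ?e\<close> remains between the outer ones.\<close>
    have "(?S * ?e * ?R) * N * (?S * ?e * ?R) = ?S * ?e * (?R * N) * ?S * ?e * ?R"
      using cN by (simp add: square_mat_mult_assoc[of _ n])
    also have "\<dots> = ?S * ?e * N * (?R * ?S) * ?e * ?R"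
      unfolding RN[OF g] using cN by (simp add: square_mat_mult_assoc[of _ n])
    also have "\<dots> = ?S * (?e * N * ?e) * ?R"
      using cN g by (simp add: trans_mat_inv square_mat_mult_assoc[of _ n])
    also have "\<dots> = ?S * (C * ?e) * ?R" unfolding \<nu> Ce ..
    also have "\<dots> = C * (?S * ?e * ?R)"
      using cC Cz by (simp add: trans_mat_def square_mat_mult_assoc[of _ n] square_mat_left_commute[OF Cz, of n])
    finally have "(?S * ?e * ?R) * N * (?S * ?e * ?R) = C * (?S * ?e * ?R)" .
    then show "A g * N * A g = ?\<alpha> \<cdot>\<^sub>m C * A g"
      unfolding A using cN cC
      by (simp add: mult_smult_distrib[of _ n n _ n] mult_smult_assoc_mat[of _ n n _ n])
  qed (use N F in auto)
qed

end


section \<open>Entries of the coset states\<close>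

lemma coset_coeff_eq:
  fixes G (structure)
  assumes G: "group G" and fin: "finite (carrier G)" and H: "subgroup H G"
    and gcx: "g \<in> carrier G" "c \<in> carrier G" "x \<in> carrier G"
  shows "coset_coeff G H g c x = 1 / complex_of_real (sqrt (real (card H))) *
    (if g \<otimes>\<^bsub>G\<^esub> inv\<^bsub>G\<^esub> c \<otimes>\<^bsub>G\<^esub> x \<otimes>\<^bsub>G\<^esub> inv\<^bsub>G\<^esub> g \<in> H then 1 else 0)"
proof -
  interpret group G by (rule G)
  have HG: "h \<in> carrier G" if "h \<in> H" for h using H that by (rule subgroup.mem_carrier)
  have cs: "conj_subgroup G H g = (\<lambda>h. inv g \<otimes> h \<otimes> g) ` H"
    unfolding conj_subgroup_def l_coset_def r_coset_def by auto
  have "finite H" using H fin by (metis finite_subset subgroup.subset)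
  then have "finite (conj_subgroup G H g)" unfolding cs by simp
  then have "(\<Sum>h\<in>conj_subgroup G H g. if x = c \<otimes> h then 1 else 0) =
      (if inv c \<otimes> x \<in> conj_subgroup G H g then 1 else (0::complex))"
  proof -
    have "x = c \<otimes> h \<longleftrightarrow> h = inv c \<otimes> x" if "h \<in> conj_subgroup G H g" for h
    proof -
      have "h \<in> carrier G" using that gcx HG unfolding cs by auto
      then show ?thesis using gcx by (metis inv_solve_left)
    qed
    then have "(\<Sum>h\<in>conj_subgroup G H g. if x = c \<otimes> h then 1 else 0) =
        (\<Sum>h\<in>conj_subgroup G H g. if h = inv c \<otimes> x then 1 else (0::complex))"
      by (intro sum.cong) auto
    then show ?thesis using \<open>finite (conj_subgroup G H g)\<close> by simp
  qed
  moreover have "inv c \<otimes> x \<in> conj_subgroup G H g \<longleftrightarrow> g \<otimes> inv c \<otimes> x \<otimes> inv g \<in> H"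
  proof
    assume "inv c \<otimes> x \<in> conj_subgroup G H g"
    then obtain h where h: "h \<in> H" and e: "inv c \<otimes> x = inv g \<otimes> h \<otimes> g" unfolding cs by auto
    have "g \<otimes> inv c \<otimes> x \<otimes> inv g = g \<otimes> (inv c \<otimes> x) \<otimes> inv g" using gcx by (simp add: m_assoc)
    also have "\<dots> = h" unfolding e using gcx HG[OF h]
      by (simp add: m_assoc) (simp add: m_assoc[symmetric])
    finally show "g \<otimes> inv c \<otimes> x \<otimes> inv g \<in> H" using h by simp
  next
    assume h: "g \<otimes> inv c \<otimes> x \<otimes> inv g \<in> H"
    have "inv c \<otimes> x = inv g \<otimes> (g \<otimes> inv c \<otimes> x \<otimes> inv g) \<otimes> g"
      using gcx by (simp add: m_assoc) (simp add: m_assoc[symmetric])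
    then show "inv c \<otimes> x \<in> conj_subgroup G H g" unfolding cs using h by blast
  qed
  ultimately show ?thesis unfolding coset_coeff_def by simp
qed

text \<open>The cosets c H^g containing x come from exactly |H| elements c, namely those of x H^g.
  Each such coset contains y iff x^-1 y lies in H^g. The count |H| cancels the normalization of the
  coset vectors, so the state is a convolution by the indicator of H^g, up to 1 / |G|.\<close>

lemma single_coset_state_eq:
  fixes G (structure)
  assumes G: "group G" and fin: "finite (carrier G)" and H: "subgroup H G"
    and gxy: "g \<in> carrier G" "x \<in> carrier G" "y \<in> carrier G"
  shows "single_coset_state G H g x y = 1 / of_nat (card (carrier G)) *
    (if g \<otimes>\<^bsub>G\<^esub> (inv\<^bsub>G\<^esub> x \<otimes>\<^bsub>G\<^esub> y) \<otimes>\<^bsub>G\<^esub> inv\<^bsub>G\<^esub> g \<in> H then 1 else 0)"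
proof -
  interpret group G by (rule G)
  have HG: "h \<in> carrier G" if "h \<in> H" for h using H that by (rule subgroup.mem_carrier)
  have finH: "finite H" using H fin by (metis finite_subset subgroup.subset)
  have cH: "card H > 0" using finH H by (metis card_gt_0_iff empty_iff subgroup.one_closed)
  define q where "q c z \<longleftrightarrow> g \<otimes> inv c \<otimes> z \<otimes> inv g \<in> H" for c z
  let ?r = "1 / complex_of_real (sqrt (real (card H)))"
  have rr: "?r * cnj ?r = 1 / of_nat (card H)"
    by (simp flip: of_real_mult)
  have qq: "q c y \<longleftrightarrow> g \<otimes> (inv x \<otimes> y) \<otimes> inv g \<in> H" if c: "c \<in> carrier G" and qx: "q c x" for c
  proof -
    let ?a = "g \<otimes> inv c \<otimes> x \<otimes> inv g" and ?t = "g \<otimes> (inv x \<otimes> y) \<otimes> inv g"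
    have a: "?a \<in> H" using qx by (simp add: q_def)
    have ac: "?a \<in> carrier G" "?t \<in> carrier G" using gxy c by auto
    \<comment> \<open>\<open>?a\<close> expresses that x lies in c H^g, and multiplying by
      \<open>?t\<close> gives the corresponding element for y. As \<open>?a\<close> is in
      \<open>H\<close>, membership of y is decided by \<open>?t\<close>, independently of c.\<close>
    have at: "?a \<otimes> ?t = g \<otimes> inv c \<otimes> y \<otimes> inv g"
      using gxy c by (simp add: m_assoc mult_inv_cancel)
    show ?thesis
    proof
      assume "q c y"
      then have "inv ?a \<otimes> (?a \<otimes> ?t) \<in> H" unfolding at q_def using a H by (simp add: subgroup.m_closed subgroup.m_inv_closed)
      also have "inv ?a \<otimes> (?a \<otimes> ?t) = ?t" using ac by (metis inv_closed l_inv l_one m_assoc)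
      finally show "?t \<in> H" .
    next
      assume "?t \<in> H"
      then have "?a \<otimes> ?t \<in> H" using a H by (simp add: subgroup.m_closed)
      then show "q c y" unfolding at q_def .
    qed
  qed
  have "{c \<in> carrier G. q c x} = (\<lambda>h. x \<otimes> inv g \<otimes> h \<otimes> g) ` H"
  proof (intro equalityI subsetI)
    fix c assume "c \<in> {c \<in> carrier G. q c x}"
    then have c: "c \<in> carrier G" and h: "g \<otimes> inv c \<otimes> x \<otimes> inv g \<in> H" by (auto simp: q_def)
    have "inv (g \<otimes> inv c \<otimes> x \<otimes> inv g) \<in> H" using h H by (simp add: subgroup.m_inv_closed)
    moreover have "c = x \<otimes> inv g \<otimes> inv (g \<otimes> inv c \<otimes> x \<otimes> inv g) \<otimes> g"
      using c gxy by (simp add: inv_mult_group m_assoc) (simp add: m_assoc[symmetric])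
    ultimately show "c \<in> (\<lambda>h. x \<otimes> inv g \<otimes> h \<otimes> g) ` H" by blast
  next
    fix c assume "c \<in> (\<lambda>h. x \<otimes> inv g \<otimes> h \<otimes> g) ` H"
    then obtain h where h: "h \<in> H" and c: "c = x \<otimes> inv g \<otimes> h \<otimes> g" by auto
    have "g \<otimes> inv c \<otimes> x \<otimes> inv g = inv h"
      unfolding c using gxy HG[OF h] by (simp add: inv_mult_group m_assoc) (simp add: m_assoc[symmetric])
    then show "c \<in> {c \<in> carrier G. q c x}"
      using h H HG gxy unfolding q_def c by (simp add: subgroup.m_inv_closed)
  qed
  moreover have "inj_on (\<lambda>h. x \<otimes> inv g \<otimes> h \<otimes> g) H"
    by (rule inj_onI) (use gxy HG in \<open>simp add: m_assoc\<close>)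
  ultimately have card: "card {c \<in> carrier G. q c x} = card H" by (simp add: card_image)
  have "(\<Sum>c\<in>carrier G. coset_coeff G H g c x * cnj (coset_coeff G H g c y)) =
      (\<Sum>c\<in>carrier G. if q c x then 1 / of_nat (card H) * (if g \<otimes> (inv x \<otimes> y) \<otimes> inv g \<in> H then 1 else 0) else 0)"
  proof (intro sum.cong refl)
    fix c assume c: "c \<in> carrier G"
    have "coset_coeff G H g c x * cnj (coset_coeff G H g c y) =
        (?r * cnj ?r) * ((if q c x then 1 else 0) * (if q c y then 1 else 0))"
      using coset_coeff_eq[OF G fin H gxy(1) c] gxy by (simp add: q_def)
    then show "coset_coeff G H g c x * cnj (coset_coeff G H g c y) =
        (if q c x then 1 / of_nat (card H) * (if g \<otimes> (inv x \<otimes> y) \<otimes> inv g \<in> H then 1 else 0) else 0)"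
      unfolding rr using qq[OF c] by auto
  qed
  also have "\<dots> = of_nat (card {c \<in> carrier G. q c x}) * (1 / of_nat (card H) * (if g \<otimes> (inv x \<otimes> y) \<otimes> inv g \<in> H then 1 else 0))"
    using fin by (simp add: sum.If_cases Collect_conj_eq Int_commute)
  also have "\<dots> = (if g \<otimes> (inv x \<otimes> y) \<otimes> inv g \<in> H then 1 else 0)"
    unfolding card using cH by simp
  finally show ?thesis unfolding single_coset_state_def by simp
qed

lemma (in enumerated_group) conjugate_subgroup_proj:
  assumes L: "subgroup L K" and u: "u \<in> carrier K"
  shows "trans_mat (inv u) * subgroup_proj L * trans_mat u =
    conv_mat (\<lambda>x. if u \<otimes> x \<otimes> inv u \<in> L then 1 / of_nat (card L) else 0)"
  unfolding subgroup_proj_def using u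
  by (simp add: trans_mat_mult_conv_mat conv_mat_mult_trans_mat m_assoc cong: conv_mat_cong)

theorem theorem5:
  fixes G :: "('a, 'm) monoid_scheme"
    and H :: "'a set"
    and k :: nat
    and b :: "nat \<Rightarrow> nat \<Rightarrow> 'a"
    and F :: "'a \<Rightarrow> complex mat"
  assumes "group G" and "finite (carrier G)"
    and "subgroup H G" and "gelfand_pair G H"
    and "k > 0"
    and "bij_betw b {..<card (carrier G) ^ k} (tuples G k)"
    and "measurement (card (carrier G) ^ k) (carrier G) F"
  shows "success_prob (carrier G) (\<lambda>_. 1 / real (card (carrier G))) (coset_state G H k b) F
       \<le> success_prob (carrier G) (\<lambda>_. 1 / real (card (carrier G))) (coset_state G H k b)
           (pgm (card (carrier G) ^ k) (carrier G)
              (\<lambda>_. 1 / real (card (carrier G))) (coset_state G H k b))"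
proof -
  interpret G: group G by (rule assms(1))
  let ?K = "product_group {..<k} (\<lambda>_. G)" and ?L = "{..<k} \<rightarrow>\<^sub>E H"
  let ?n = "card (carrier G) ^ k" and ?m = "card (carrier G)"
  let ?\<rho> = "coset_state G H k b"
  interpret K: group ?K by (rule product_group) (rule assms(1))
  interpret E: enumerated_group ?K ?n b
    by unfold_locales (use assms(6) in simp)
  \<comment> \<open>The diagonal embedding, restricted to the index set because elements of the
    product group are extensional.\<close>
  define \<gamma> :: "'a \<Rightarrow> nat \<Rightarrow> 'a" where "\<gamma> g = (\<lambda>i\<in>{..<k}. g)" for g
  have L: "subgroup ?L ?K" using assms(1,3) by (simp add: PiE_subgroup_product_group)
  have gel: "gelfand_pair ?K ?L" by (rule gelfand_pair_product_group) (use assms in auto)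
  have \<gamma>: "\<gamma> \<in> hom G ?K" by (auto simp: hom_def \<gamma>_def fun_eq_iff)
  have \<gamma>c: "\<gamma> g \<in> carrier ?K" if "g \<in> carrier G" for g using \<gamma> that by (rule hom_in_carrier)
  \<comment> \<open>One factor 1 / |G| is the prior probability, the other k come from averaging
    over the coset representatives; \<open>card ?L\<close> undoes the normalization 1 / |L| of the
    subgroup projection.\<close>
  define \<alpha> :: real where "\<alpha> = real (card ?L) / real ?m ^ Suc k"
  have m0: "?m > 0" using assms(2) by (metis G.one_closed card_gt_0_iff empty_iff)
  have L0: "card ?L > 0" by (rule E.card_L[OF L])
  define p where "p = 1 / real ?m"
  define A where "A g = complex_of_real \<alpha> \<cdot>\<^sub>m
    (E.trans_mat (inv\<^bsub>?K\<^esub> (\<gamma> g)) * E.subgroup_proj ?L * E.trans_mat (\<gamma> g))" for g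
  have A\<rho>: "A g = complex_of_real p \<cdot>\<^sub>m ?\<rho> g" if g: "g \<in> carrier G" for g
  proof (rule eq_matI)
    fix i j assume "i < dim_row (complex_of_real p \<cdot>\<^sub>m ?\<rho> g)" "j < dim_col (complex_of_real p \<cdot>\<^sub>m ?\<rho> g)"
    then have ij: "i < ?n" "j < ?n" by (auto simp: coset_state_def)
    have bi: "b i \<in> carrier ?K" "b j \<in> carrier ?K" by (rule E.b_closed[OF ij(1)], rule E.b_closed[OF ij(2)])
    let ?x = "inv\<^bsub>?K\<^esub> (b i) \<otimes>\<^bsub>?K\<^esub> b j"
    \<comment> \<open>The left side is the kernel of the conjugated projection; the right side
      consists of the k single-register conditions, one per tensor factor.\<close>
    have mem: "\<gamma> g \<otimes>\<^bsub>?K\<^esub> ?x \<otimes>\<^bsub>?K\<^esub> inv\<^bsub>?K\<^esub> (\<gamma> g) \<in> ?L \<longleftrightarrow>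
        (\<forall>l<k. g \<otimes>\<^bsub>G\<^esub> (inv\<^bsub>G\<^esub> (b i l) \<otimes>\<^bsub>G\<^esub> b j l) \<otimes>\<^bsub>G\<^esub> inv\<^bsub>G\<^esub> g \<in> H)"
      using bi \<gamma>c[OF g] assms(1) by (auto simp: inv_product_group PiE_iff \<gamma>_def)
    have "?\<rho> g $$ (i, j) = (\<Prod>l<k. single_coset_state G H g (b i l) (b j l))"
      by (rule coset_state_tensor_power[OF assms(2) ij])
    also have "\<dots> = (\<Prod>l<k. 1 / of_nat ?m *
        (if g \<otimes>\<^bsub>G\<^esub> (inv\<^bsub>G\<^esub> (b i l) \<otimes>\<^bsub>G\<^esub> b j l) \<otimes>\<^bsub>G\<^esub> inv\<^bsub>G\<^esub> g \<in> H then 1 else 0))"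
      using bi by (intro prod.cong refl single_coset_state_eq[OF assms(1-3) g]) auto
    also have "\<dots> = (1 / of_nat ?m) ^ k * (if \<gamma> g \<otimes>\<^bsub>?K\<^esub> ?x \<otimes>\<^bsub>?K\<^esub> inv\<^bsub>?K\<^esub> (\<gamma> g) \<in> ?L then 1 else 0)"
      unfolding mem prod.distrib by (auto intro!: prod_zero prod.neutral)
    finally have "?\<rho> g $$ (i, j) =
        (1 / of_nat ?m) ^ k * (if \<gamma> g \<otimes>\<^bsub>?K\<^esub> ?x \<otimes>\<^bsub>?K\<^esub> inv\<^bsub>?K\<^esub> (\<gamma> g) \<in> ?L then 1 else 0)" .
    moreover have "A g $$ (i, j) = complex_of_real \<alpha> *
        (if \<gamma> g \<otimes>\<^bsub>?K\<^esub> ?x \<otimes>\<^bsub>?K\<^esub> inv\<^bsub>?K\<^esub> (\<gamma> g) \<in> ?L then 1 / of_nat (card ?L) else 0)"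
      unfolding A_def E.conjugate_subgroup_proj[OF L \<gamma>c[OF g]] using ij by (simp del: mult_product_group)
    moreover have "complex_of_real \<alpha> / of_nat (card ?L) = complex_of_real p * (1 / of_nat ?m) ^ k"
      using L0 m0 by (simp add: \<alpha>_def p_def power_one_over field_simps)
    ultimately show "A g $$ (i, j) = (complex_of_real p \<cdot>\<^sub>m ?\<rho> g) $$ (i, j)"
      using ij by (auto simp: coset_state_def)
  qed (auto simp: A_def coset_state_def carrier_matD[OF E.trans_mat_carrier])
  have \<rho>c: "?\<rho> g \<in> carrier_mat ?n ?n" for g by (simp add: coset_state_def)
  define N where "N = inv_sqrt_mat ?n (sum_mat ?n A (carrier G))"
  have N': "N = inv_sqrt_mat ?n (sum_mat ?n (\<lambda>j. complex_of_real p \<cdot>\<^sub>m ?\<rho> j) (carrier G))"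
    unfolding N_def by (rule arg_cong[of _ _ "inv_sqrt_mat ?n"]) (rule sum_mat_cong, rule A\<rho>)
  have "psd ?n (sum_mat ?n A (carrier G))"
  proof (rule psd_sum_mat)
    fix g assume g: "g \<in> carrier G"
    have "psd ?n (E.trans_mat (inv\<^bsub>?K\<^esub> (\<gamma> g)) * E.subgroup_proj ?L * E.trans_mat (\<gamma> g))"
      using psd_conj[OF E.psd_subgroup_proj[OF L] E.trans_mat_carrier, of "\<gamma> g"] E.mat_adjoint_trans_mat[OF \<gamma>c[OF g]] by simp
    then show "psd ?n (A g)" unfolding A_def by (rule psd_smult) (simp add: \<alpha>_def)
  qed
  then have Nc: "N \<in> carrier_mat ?n ?n" unfolding N_def by (simp add: inv_sqrt_mat_eq psd_hermitian)
  have tr: "trace_mat (c \<cdot>\<^sub>m X) = c * trace_mat X" if "X \<in> carrier_mat ?n ?n" for c X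
    using that by (simp add: trace_mat_def sum_distrib_left)
  have main: "(\<Sum>g\<in>carrier G. Re (trace_mat (F g * A g))) \<le> (\<Sum>g\<in>carrier G. Re (trace_mat (N * A g * N * A g)))"
    by (rule E.pretty_good_optimal_conjugates[OF L gel assms(1,2) \<gamma>, of \<alpha> A N F])
      (simp_all add: \<alpha>_def A_def N_def assms(7) del: carrier_product_group mult_product_group inv_product_group)
  have "success_prob (carrier G) (\<lambda>_. p) ?\<rho> F = (\<Sum>g\<in>carrier G. Re (trace_mat (F g * A g)))"
    unfolding success_prob_def
  proof (rule sum.cong[OF refl])
    fix g assume g: "g \<in> carrier G"
    have "F g \<in> carrier_mat ?n ?n" using assms(7) g by (auto simp: measurement_def psd_carrier)
    then show "p * Re (trace_mat (F g * ?\<rho> g)) = Re (trace_mat (F g * A g))"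
      unfolding A\<rho>[OF g] using \<rho>c by (simp add: mult_smult_distrib[of _ ?n ?n _ ?n] tr)
  qed
  moreover have "success_prob (carrier G) (\<lambda>_. p) ?\<rho> (pgm ?n (carrier G) (\<lambda>_. p) ?\<rho>) =
      (\<Sum>g\<in>carrier G. Re (trace_mat (N * A g * N * A g)))"
    unfolding success_prob_def
  proof (rule sum.cong[OF refl])
    fix g assume g: "g \<in> carrier G"
    have "pgm ?n (carrier G) (\<lambda>_. p) ?\<rho> g = complex_of_real p \<cdot>\<^sub>m (N * ?\<rho> g * N)"
      unfolding pgm_def Let_def N' ..
    \<comment> \<open>One \<open>p\<close> is the prior weight and the other sits in the measurement
      operator; together they turn both occurrences of \<open>?\<rho> g\<close> into
      \<open>A g\<close>.\<close>
    then show "p * Re (trace_mat (pgm ?n (carrier G) (\<lambda>_. p) ?\<rho> g * ?\<rho> g)) = Re (trace_mat (N * A g * N * A g))"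
      unfolding A\<rho>[OF g] using \<rho>c[of g] Nc
      by (simp add: mult_smult_distrib[of _ ?n ?n _ ?n] mult_smult_assoc_mat[of _ ?n ?n _ ?n] tr)
  qed
  ultimately show ?thesis using main unfolding p_def by simp
qed

end
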